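(* Let $q$ be an odd prime power that does not belong to the set $S=\{3, 5, 7, 9, 11, 13, 17, 19, 23, 25, 27, 29, 31, 37, 41, 43, 47, 49, 53, 59, 61, 67, 71, 73, 79, 81, 83, 89, 97, 101, 103, 109, 113, 121, 125, 127, 131, 137, 139, 149, 151, 157, 169, 173, 181, 191, 197, 199, 211, 229, 239, 241, 269, 281, 307, 311, 331, 337, 349, 361, 373, 379, 389, 409, 419, 421, 461, 463, 509, 521, 529, 569, 571, 601, 617, 631, 659, 661, 701, 761, 769, 841, 859, 881, 911, 1009, 1021, 1231, 1289, 1301, 1331, 1429, 1609, 1741, 1849, 1861, 2029, 2281, 2311, 2729, 3541\}$. Then for every $\beta\in\mathbb{F}_q^*$ there exists a $2$-primitive element $\xi\in\mathbb{F}_{q^2}$ such that $\mathrm{Tr}(\xi)=\beta$.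
   Context: $\mathbb{F}_q$ is the finite field with $q$ elements and $\mathbb{F}_{q^2}$ its quadratic extension. $\mathrm{Tr}:\mathbb{F}_{q^2}\to\mathbb{F}_q$ is the trace map $\mathrm{Tr}(\xi)=\xi+\xi^q$. An element $\xi\in\mathbb{F}_{q^2}$ is called $2$-primitive if its multiplicative order is $(q^2-1)/2$. *)

theory Defs
  imports
    "HOL-Algebra.Multiplicative_Group"
    "HOL-Algebra.Subrings"
    "HOL-Number_Theory.Prime_Powers"
begin

text \<open>
  Throughout, \<open>L\<close> is a field with \<open>q\<^sup>2\<close> elements, playing the role of
  \<open>\<bbbF>\<^bsub>q\<^sup>2\<^esub>\<close>; the field \<open>\<bbbF>\<^bsub>q\<^esub>\<close> is represented by its (unique) subfield with \<open>q\<close> elements.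
\<close>

definition quad_trace :: "('a, 'b) ring_scheme \<Rightarrow> nat \<Rightarrow> 'a \<Rightarrow> 'a" where
  "quad_trace L q \<xi> = \<xi> \<oplus>\<^bsub>L\<^esub> \<xi> [^]\<^bsub>L\<^esub> q"

text \<open>
  The first conjunct is needed because \<open>group.ord\<close> is only meaningful on the carrier of
  the multiplicative group. For odd \<open>q\<close> the division is exact.
\<close>

definition two_primitive :: "('a, 'b) ring_scheme \<Rightarrow> nat \<Rightarrow> 'a \<Rightarrow> bool" where
  "two_primitive L q \<xi> \<longleftrightarrow>
     \<xi> \<in> carrier (Multiplicative_Group.mult_of L) \<and>
     group.ord (Multiplicative_Group.mult_of L) \<xi> = (q\<^sup>2 - 1) div 2"

definition exceptional_set :: "nat set" where
  "exceptional_set =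
    {3, 5, 7, 9, 11, 13, 17, 19, 23, 25, 27, 29, 31, 37, 41, 43, 47, 49, 53, 59, 61, 67,
     71, 73, 79, 81, 83, 89, 97, 101, 103, 109, 113, 121, 125, 127, 131, 137, 139, 149,
     151, 157, 169, 173, 181, 191, 197, 199, 211, 229, 239, 241, 269, 281, 307, 311, 331,
     337, 349, 361, 373, 379, 389, 409, 419, 421, 461, 463, 509, 521, 529, 569, 571, 601,
     617, 631, 659, 661, 701, 761, 769, 841, 859, 881, 911, 1009, 1021, 1231, 1289, 1301,
     1331, 1429, 1609, 1741, 1849, 1861, 2029, 2281, 2311, 2729, 3541}"

end

theory Submission
  imports Defs Complex_Main
begin

text \<open>
  Let \<open>g\<close> generate the multiplicative group of \<open>\<bbbF>\<^bsub>q\<^sup>2\<^esub>\<close> and let \<open>A\<close> be the set of exponents modulo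
  \<open>M = q\<^sup>2 - 1\<close> of the \<open>q\<close> elements of trace \<open>\<beta>\<close>; we look for \<open>a \<in> A\<close> with \<open>gcd(a, M) = 2\<close>. Dividing
  the elements of trace \<open>\<beta>\<close> by each other hits every element outside \<open>\<bbbF>\<^bsub>q\<^esub>\<close> exactly once, so \<open>A\<close> is a
  relative difference set and a non-trivial character sum over \<open>A\<close> has absolute value \<open>1\<close> or \<open>\<surd>q\<close>,
  according to whether the character is trivial on \<open>\<bbbF>\<^bsub>q\<^esub>\<close>. Hence the number of \<open>a \<equiv> 2 (mod 4)\<close> in \<open>A\<close>
  that are divisible by a given odd prime of \<open>M\<close> is close to its expected value. Sieving by the odd
  primes of \<open>M\<close>, where the prime 3 may be treated exactly instead of being sieved, settles every
  \<open>q\<close> for which an explicit inequality in the prime factors of \<open>q - 1\<close> and \<open>q + 1\<close> holds. For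
  \<open>q \<ge> 14610\<close> the inequality follows from \<open>M\<close> being at least 8 times the product of its odd primes
  (inclusion-exclusion over all primes replaces the sieve when there are very many of them); for
  smaller \<open>q\<close> it is verified by computation.
\<close>

section \<open>Character sums and the sieve\<close>

text \<open>The element g^a has order M / gcd(a, M), and 4 divides M, so the wanted order means that
  a is 2 modulo 4 and that no odd prime of M divides a. The sieve is a union bound: it can only
  succeed while the reciprocals of the sieved primes add up to less than 1, and the prime 3 alone
  would use up a third of that. Treating 3 exactly avoids this loss, but doubles the absolute sum of
  the coefficients of the weight relative to its mean, from 4 to 8. Both variants are therefore
  kept. Characters trivial on F_q cost 1 instead of sqrt q. Multiplying by a character of order l
  preserves this triviality when l divides q + 1, and this is why the primes of q - 1 and of q + 1
  are kept apart. For large q the gain is given up. The bound 14610 comes from the case of at most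
  six primes of M besides 2 and 3: the estimate used there, 40 < 0.37785 (sqrt q - 15), holds from
  about sqrt q = 120.87 on.\<close>

definition ecis :: "nat \<Rightarrow> nat \<Rightarrow> nat \<Rightarrow> complex" where
  "ecis M j a = cis (2 * pi * real j * real a / real M)"

lemma norm_ecis [simp]: "cmod (ecis M j a) = 1"
  by (simp add: ecis_def)

lemma ecis_0 [simp]: "ecis M 0 a = 1" "ecis M j 0 = 1"
  by (simp_all add: ecis_def)

lemma ecis_add_left: "ecis M (i + j) a = ecis M i a * ecis M j a"
  by (simp add: ecis_def cis_mult add_divide_distrib ring_distribs)

lemma ecis_commute: "ecis M i a = ecis M a i"
  by (simp add: ecis_def mult_ac)

lemma ecis_add_right: "ecis M i (a + b) = ecis M i a * ecis M i b"
  by (metis ecis_add_left ecis_commute)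

lemma ecis_mult_left: "ecis M (k * j) a = ecis M j a ^ k"
  by (simp add: ecis_def DeMoivre mult_ac)

lemma ecis_period:
  assumes "0 < M"
  shows "ecis M (M * k) a = 1"
proof -
  have "2 * pi * real (M * k) * real a / real M = 2 * pi * real (k * a)"
    using assms by (simp add: field_simps)
  then have "ecis M (M * k) a = cis (2 * pi * real (k * a))"
    unfolding ecis_def by presburger
  also have "\<dots> = 1"
    by (rule cis_multiple_2pi) auto
  finally show ?thesis .
qed

lemma ecis_mod_right:
  assumes "0 < M"
  shows "ecis M j (a mod M) = ecis M j a"
proof -
  have "ecis M j a = ecis M j (M * (a div M) + a mod M)"
    by simp
  also have "\<dots> = ecis M j (M * (a div M)) * ecis M j (a mod M)"
    by (rule ecis_add_right)
  also have "ecis M j (M * (a div M)) = 1"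
    using ecis_period[OF assms] ecis_commute by metis
  finally show ?thesis by simp
qed

text \<open>The frequencies \<open>k * (M div d)\<close> are those of the characters modulo d.
  Conditions on divisibility by d thereby become shifts of the frequency.\<close>

lemma ecis_cancel:
  assumes "0 < d" "d dvd M" "0 < M"
  shows "ecis M (k * (M div d)) a = ecis d k a"
proof -
  have "real M = real d * real (M div d)" "real (M div d) \<noteq> 0"
    using assms by (auto simp flip: of_nat_mult)
  then show ?thesis
    using assms unfolding ecis_def by (simp add: field_simps)
qed

lemma ecis_eq_1_iff:
  assumes "0 < n"
  shows "ecis n j 1 = 1 \<longleftrightarrow> n dvd j"
proof
  assume "ecis n j 1 = 1"
  then have "cos (2 * pi * real j / real n) = 1"
    by (simp add: ecis_def complex_eq_iff)
  then obtain m :: int where "2 * pi * real j / real n = of_int m * 2 * pi"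
    using cos_one_2pi_int by blast
  then have "real j = of_int m * real n"
    using assms by (simp add: field_simps)
  then have "of_int (int j) = (of_int (m * int n) :: real)"
    by simp
  then have "int j = m * int n"
    by (simp only: of_int_eq_iff)
  then show "n dvd j"
    by (metis dvd_triv_right int_dvd_int_iff)
next
  assume "n dvd j"
  then show "ecis n j 1 = 1"
    using ecis_period[OF assms] by (metis dvdE)
qed

lemma sum_ecis:
  assumes "0 < n"
  shows "(\<Sum>k<n. ecis n k a) = (if n dvd a then of_nat n else 0)"
proof -
  have eq: "ecis n k a = ecis n a 1 ^ k" for k
    using ecis_mult_left[of n k 1 a] ecis_commute[of n 1 a] by simp
  show ?thesis
  proof (cases "n dvd a")
    case True
    then show ?thesis using eq ecis_eq_1_iff[OF assms, of a] by simp
  next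
    case False
    then have "ecis n a 1 \<noteq> 1" using ecis_eq_1_iff[OF assms] by simp
    moreover have "ecis n a 1 ^ n = 1"
      using eq[of n] ecis_period[OF assms, of 1 a] by simp
    ultimately show ?thesis using False eq by (simp add: geometric_sum)
  qed
qed

text \<open>The interface between the field and the sieve. If g generates the multiplicative group
  of the quadratic extension, then g^(q+1) generates that of F_q, so \<open>(q - 1) dvd j\<close>
  says that the character of frequency j is trivial on F_q.\<close>

locale spectral_set =
  fixes q :: nat and A :: "nat set"
  assumes q_odd: "odd q" and q_gt_1: "1 < q"
    and finite_A: "finite A" and card_A: "card A = q"
    and spectral_bound: "\<And>j. \<not> (q\<^sup>2 - 1) dvd j \<Longrightarrow>
          cmod (\<Sum>a\<in>A. ecis (q\<^sup>2 - 1) j a) \<le> sqrt q"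
    and spectral_bound_1: "\<And>j. \<not> (q\<^sup>2 - 1) dvd j \<Longrightarrow> (q - 1) dvd j \<Longrightarrow>
          cmod (\<Sum>a\<in>A. ecis (q\<^sup>2 - 1) j a) \<le> 1"
begin

definition M where "M = q\<^sup>2 - 1"

lemma M_eq: "M = (q - 1) * (q + 1)"
  unfolding M_def by (simp add: power2_eq_square algebra_simps diff_mult_distrib2)

lemma q_ge_3: "3 \<le> q"
  using q_odd q_gt_1 by presburger

lemma M_pos: "0 < M"
  using q_gt_1 by (simp add: M_eq)

lemma eight_dvd_M: "8 dvd M"
proof -
  obtain k where k: "q = 2 * k + 1" using q_odd by (auto elim: oddE)
  have "(q - 1) * (q + 1) = 4 * (k * (k + 1))" unfolding k by (simp add: algebra_simps)
  moreover have "4 * 2 dvd 4 * (k * (k + 1))" by (intro mult_dvd_mono) auto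
  ultimately show ?thesis unfolding M_eq by simp
qed

section \<open>Weighted character sums\<close>

definition W :: "(nat \<Rightarrow> real) \<Rightarrow> nat \<Rightarrow> complex" where
  "W h j = (\<Sum>a\<in>A. of_real (h a) * ecis M j a)"

lemma W_0: "W h 0 = of_real (\<Sum>a\<in>A. h a)"
  by (simp add: W_def)

lemma W_diff: "W (\<lambda>a. g a - h a) j = W g j - W h j"
  by (simp add: W_def sum_subtractf left_diff_distrib)

text \<open>The indicator of \<open>d dvd a\<close> is the average of the d characters modulo d, so
  multiplying the weight by it averages W over d shifts of the frequency.\<close>

lemma W_dvd:
  assumes "0 < d" "d dvd M"
  shows "W (\<lambda>a. h a * of_bool (d dvd a)) j = (\<Sum>k<d. W h (j + k * (M div d))) / of_nat d"
proof -
  have "(\<Sum>k<d. W h (j + k * (M div d))) =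
      (\<Sum>k<d. \<Sum>a\<in>A. of_real (h a) * ecis M j a * ecis d k a)"
    unfolding W_def ecis_add_left ecis_cancel[OF assms M_pos] by (simp add: mult.assoc)
  also have "\<dots> = (\<Sum>a\<in>A. of_real (h a) * ecis M j a * (\<Sum>k<d. ecis d k a))"
    by (subst sum.swap) (simp add: sum_distrib_left)
  also have "\<dots> = (\<Sum>a\<in>A. of_nat d * (of_real (h a * of_bool (d dvd a)) * ecis M j a))"
    unfolding sum_ecis[OF assms(1)] by (intro sum.cong) auto
  also have "\<dots> = of_nat d * W (\<lambda>a. h a * of_bool (d dvd a)) j"
    unfolding W_def by (simp add: sum_distrib_left)
  finally show ?thesis using assms by simp
qed

lemma W_one_bound: "\<not> M dvd j \<Longrightarrow> cmod (W (\<lambda>_. 1) j) \<le> sqrt q"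
  and W_one_bound_1: "\<not> M dvd j \<Longrightarrow> (q - 1) dvd j \<Longrightarrow> cmod (W (\<lambda>_. 1) j) \<le> 1"
  using spectral_bound spectral_bound_1 by (simp_all add: W_def M_def)

definition two_mod_four :: "nat \<Rightarrow> real" where
  "two_mod_four a = of_bool (a mod 4 = 2)"

lemma W_two_mod_four:
  "W two_mod_four j =
    (W (\<lambda>_. 1) j - W (\<lambda>_. 1) (j + M div 4) + W (\<lambda>_. 1) (j + 2 * (M div 4))
      - W (\<lambda>_. 1) (j + 3 * (M div 4))) / 4"
proof -
  have M4: "4 dvd M" "2 dvd M" "M div 2 = 2 * (M div 4)"
    using eight_dvd_M by (auto elim!: dvdE)
  \<comment> \<open>With x a character of order 4, (1 + x^2)/2 - (1 + x + x^2 + x^3)/4 = (1 - x +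
    x^2 - x^3)/4, which explains the alternating signs.\<close>
  have eq: "two_mod_four = (\<lambda>a. 1 * of_bool (2 dvd a) - 1 * of_bool (4 dvd a))"
  proof
    fix a :: nat
    have "a mod 4 = 2 \<longleftrightarrow> 2 dvd a \<and> \<not> 4 dvd a" "4 dvd a \<Longrightarrow> 2 dvd a" by presburger+
    then show "two_mod_four a = 1 * of_bool (2 dvd a) - 1 * of_bool (4 dvd a)"
      by (auto simp: two_mod_four_def)
  qed
  have sums: "(\<Sum>k<2. f k) = f 0 + f 1" "(\<Sum>k<4. f k) = f 0 + f 1 + f 2 + f 3"
    for f :: "nat \<Rightarrow> complex"
    by (simp_all add: eval_nat_numeral)
  show ?thesis
    unfolding eq W_diff W_dvd[of 2 "\<lambda>_. 1" j, OF zero_less_numeral M4(2)]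
      W_dvd[of 4 "\<lambda>_. 1" j, OF zero_less_numeral M4(1)] sums M4(3)
    by (simp add: field_simps)
qed

text \<open>The number of characters of order dividing 4 that are trivial on \<open>\<bbbF>\<^bsub>q\<^esub>\<close>.\<close>

definition \<kappa> :: nat where "\<kappa> = (if q mod 4 = 3 then 4 else 2)"

lemma \<kappa>_cases: "\<kappa> = 2 \<or> \<kappa> = 4"
  by (simp add: \<kappa>_def)

lemma Q_ge_1: "1 \<le> sqrt q"
  using q_gt_1 by simp

lemma q_minus_1_dvd_half: "(q - 1) dvd 2 * (M div 4)"
proof -
  have "2 * (M div 4) = (q - 1) * ((q + 1) div 2)"
  proof -
    have "4 dvd M" using eight_dvd_M by (auto elim!: dvdE)
    then have "2 * (2 * (M div 4)) = M" by auto
    moreover have "2 * ((q + 1) div 2) = q + 1" using q_odd by auto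
    then have "2 * ((q - 1) * ((q + 1) div 2)) = M" unfolding M_eq
      by (metis mult.left_commute)
    ultimately show ?thesis by linarith
  qed
  then show ?thesis by simp
qed

lemma q_minus_1_dvd_quarter:
  assumes "q mod 4 = 3"
  shows "(q - 1) dvd (M div 4)"
proof -
  have "4 dvd q + 1" using assms by presburger
  then have "M div 4 = (q - 1) * ((q + 1) div 4)" unfolding M_eq by (simp only: div_mult_swap)
  then show ?thesis by simp
qed

text \<open>Multiplication by d turns the shift into a multiple of M, which does not affect
  divisibility by M.\<close>

lemma not_dvd_shift:
  assumes "\<not> M dvd d * j" "d dvd M"
  shows "\<not> M dvd j + k * (M div d)"
proof
  assume "M dvd j + k * (M div d)"
  then have "M dvd d * (j + k * (M div d))" by simp
  also have "d * (j + k * (M div d)) = d * j + k * M"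
    using assms(2) by (simp add: algebra_simps)
  finally show False using assms(1) by (simp add: dvd_add_left_iff)
qed

text \<open>Four characters with coefficients of absolute value 1/4 contribute. If q - 1 divides j,
  then \<open>\<kappa>\<close> of the shifted frequencies are again divisible by q - 1 and cost 1
  each; the others cost sqrt q.\<close>

lemma W_two_mod_four_bound:
  assumes "\<not> M dvd 4 * j"
  shows "cmod (W two_mod_four j) \<le> sqrt q"
    and "(q - 1) dvd j \<Longrightarrow> 4 * cmod (W two_mod_four j) \<le> real \<kappa> + (4 - real \<kappa>) * sqrt q"
proof -
  let ?w = "\<lambda>i. W (\<lambda>_. 1) (j + i * (M div 4))"
  have d4: "4 dvd M" using eight_dvd_M by (auto elim!: dvdE)
  have nd: "\<not> M dvd j + i * (M div 4)" for i
    using not_dvd_shift[OF assms d4] .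
  have tri: "4 * cmod (W two_mod_four j) \<le> cmod (?w 0) + cmod (?w 1) + cmod (?w 2) + cmod (?w 3)"
  proof -
    have "4 * cmod (W two_mod_four j) = cmod (?w 0 - ?w 1 + ?w 2 - ?w 3)"
      unfolding W_two_mod_four by (simp add: norm_divide)
    also have "\<dots> \<le> cmod (?w 0) + cmod (?w 1) + cmod (?w 2) + cmod (?w 3)"
      by (smt (verit) norm_triangle_ineq norm_triangle_ineq4)
    finally show ?thesis .
  qed
  have b: "cmod (?w i) \<le> sqrt q" for i
    using W_one_bound[OF nd] .
  show "cmod (W two_mod_four j) \<le> sqrt q"
    using tri b[of 0] b[of 1] b[of 2] b[of 3] by linarith
  assume j: "(q - 1) dvd j"
  have c: "cmod (?w i) \<le> 1" if "even i \<or> q mod 4 = 3" for i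
  proof (rule W_one_bound_1[OF nd])
    from that have "(q - 1) dvd i * (M div 4)"
    proof
      assume "even i"
      then obtain k where "i = 2 * k" by blast
      then have "i * (M div 4) = 2 * (M div 4) * k" by simp
      then show ?thesis using q_minus_1_dvd_half by (metis dvd_mult2)
    qed (use q_minus_1_dvd_quarter in simp)
    then show "(q - 1) dvd j + i * (M div 4)" using j by simp
  qed
  show "4 * cmod (W two_mod_four j) \<le> real \<kappa> + (4 - real \<kappa>) * sqrt q"
  proof (cases "q mod 4 = 3")
    case True
    then show ?thesis using tri c[of 0] c[of 1] c[of 2] c[of 3] by (simp add: \<kappa>_def)
  next
    case False
    then show ?thesis using tri c[of 0] b[of 1] c[of 2] b[of 3] by (simp add: \<kappa>_def)
  qed
qed

text \<open>The trivial character contributes q itself, so only \<open>\<kappa> - 1\<close> of the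
  cheap characters are left as errors.\<close>

lemma W_two_mod_four_0:
  "4 * (\<Sum>a\<in>A. two_mod_four a) \<ge> real q + 1 - real \<kappa> - (4 - real \<kappa>) * sqrt q"
proof -
  let ?w = "\<lambda>i. W (\<lambda>_. 1) (i * (M div 4))"
  have d4: "4 dvd M" "4 \<le> M" using eight_dvd_M M_pos by (auto elim!: dvdE)
  have nd: "\<not> M dvd i * (M div 4)" if "0 < i" "i < 4" for i
  proof
    assume "M dvd i * (M div 4)"
    moreover have "0 < i * (M div 4)" using that d4 by (auto simp: div_greater_zero_iff)
    moreover have "i * (M div 4) < M"
    proof -
      have "4 * (i * (M div 4)) = i * M" using d4 by auto
      also have "\<dots> < 4 * M" using that M_pos by simp
      finally show ?thesis by simp
    qed
    ultimately show False using nat_dvd_not_less by blast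
  qed
  have "W (\<lambda>_. 1) 0 = of_nat q" by (simp add: W_0 card_A)
  then have "4 * (\<Sum>a\<in>A. two_mod_four a) = Re (of_nat q - ?w 1 + ?w 2 - ?w 3)"
    using W_two_mod_four[of 0] W_0[of two_mod_four]
    by (simp add: complex_eq_iff)
  also have "\<dots> \<ge> real q - cmod (?w 1) - cmod (?w 2) - cmod (?w 3)"
    using abs_Re_le_cmod[of "?w 1"] abs_Re_le_cmod[of "?w 2"] abs_Re_le_cmod[of "?w 3"]
    by (simp, linarith)
  finally have tri: "real q - cmod (?w 1) - cmod (?w 2) - cmod (?w 3) \<le> 4 * (\<Sum>a\<in>A. two_mod_four a)" .
  have b: "cmod (?w i) \<le> sqrt q" if "0 < i" "i < 4" for i
    using W_one_bound[OF nd] that .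
  have c2: "cmod (?w 2) \<le> 1"
    by (rule W_one_bound_1[OF nd]) (use q_minus_1_dvd_half in auto)
  show ?thesis
  proof (cases "q mod 4 = 3")
    case True
    then have "cmod (?w i) \<le> 1" if "0 < i" "i < 4" for i
      using W_one_bound_1[OF nd] that q_minus_1_dvd_quarter by simp
    from this[of 1] this[of 3] show ?thesis using tri c2 True by (simp add: \<kappa>_def)
  next
    case False
    then show ?thesis using tri c2 b[of 1] b[of 3] by (simp add: \<kappa>_def)
  qed
qed

section \<open>Treating the prime 3 exactly\<close>

definition core3 :: "nat \<Rightarrow> real" where
  "core3 a = two_mod_four a * of_bool (\<not> 3 dvd a)"

text \<open>With y a character of order 3, the extra factor is (2 - y - y^2)/3. The mean of the
  weight becomes 1/4 * 2/3 = 1/6 and the absolute sum of its coefficients 4/3; this is the origin of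
  the factors 6 and 8 = 6 * 4/3 below.\<close>

lemma W_core3:
  assumes "3 dvd M"
  shows "W core3 j = (2 * W two_mod_four j - W two_mod_four (j + M div 3)
    - W two_mod_four (j + 2 * (M div 3))) / 3"
proof -
  have eq: "core3 = (\<lambda>a. two_mod_four a - two_mod_four a * of_bool (3 dvd a))"
    by (auto simp: core3_def)
  have sum3: "(\<Sum>k<3. f k) = f 0 + f 1 + f 2" for f :: "nat \<Rightarrow> complex"
    by (simp add: eval_nat_numeral)
  show ?thesis
    unfolding eq W_diff W_dvd[of 3 two_mod_four j, OF zero_less_numeral assms] sum3
    by (simp add: field_simps)
qed

lemma not_dvd_mult_div:
  assumes "l dvd M" "coprime e l" "0 < k" "k < l"
  shows "\<not> M dvd e * (k * (M div l))"
proof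
  assume "M dvd e * (k * (M div l))"
  then have "l * M dvd l * (e * (k * (M div l)))" by simp
  also have "l * (e * (k * (M div l))) = (e * k) * M"
    using assms(1) by simp
  finally have "l dvd e * k" using M_pos by simp
  then have "l dvd k" using assms(2) by (simp add: coprime_commute coprime_dvd_mult_right_iff)
  then show False using assms nat_dvd_not_less by blast
qed

lemma q_minus_1_dvd_mult_div:
  assumes "l dvd q + 1"
  shows "(q - 1) dvd k * (M div l)"
  unfolding M_eq div_mult_swap[OF assms, symmetric] by simp

text \<open>If 3 divides q + 1, the characters of order 3 are trivial on F_q, so all three shifts
  profit and the cheap weight is \<open>2 * \<kappa>\<close>. The last bound exploits the unshifted
  frequency only, which leaves \<open>\<kappa>\<close>.\<close>

lemma W_core3_bound:
  assumes "3 dvd M" "\<not> M dvd 12 * j"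
  shows "6 * cmod (W core3 j) \<le> 8 * sqrt q"
    and "3 dvd q + 1 \<Longrightarrow> (q - 1) dvd j \<Longrightarrow>
      6 * cmod (W core3 j) \<le> 2 * real \<kappa> + (8 - 2 * real \<kappa>) * sqrt q"
    and "(q - 1) dvd j \<Longrightarrow>
      6 * cmod (W core3 j) \<le> real \<kappa> + (8 - real \<kappa>) * sqrt q"
proof -
  let ?w = "\<lambda>i. W two_mod_four (j + i * (M div 3))"
  have nd: "\<not> M dvd 4 * (j + i * (M div 3))" for i
    using not_dvd_shift[of 3 "4 * j" "4 * i"] assms by (simp add: algebra_simps)
  have "6 * cmod (W core3 j) = 2 * cmod (2 * ?w 0 - ?w 1 - ?w 2)"
    unfolding W_core3[OF assms(1)] by (simp add: norm_divide)
  also have "\<dots> \<le> 2 * (cmod (2 * ?w 0) + cmod (?w 1) + cmod (?w 2))"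
    by (smt (verit) norm_triangle_ineq4)
  finally have tri: "6 * cmod (W core3 j) \<le> 4 * cmod (?w 0) + 2 * cmod (?w 1) + 2 * cmod (?w 2)"
    by (simp add: norm_mult)
  have b: "cmod (?w i) \<le> sqrt q" for i
    using W_two_mod_four_bound(1)[OF nd] .
  show "6 * cmod (W core3 j) \<le> 8 * sqrt q"
    using tri b[of 0] b[of 1] b[of 2] by linarith
  assume j: "(q - 1) dvd j"
  then have "4 * cmod (?w 0) \<le> real \<kappa> + (4 - real \<kappa>) * sqrt q"
    by (intro W_two_mod_four_bound(2)[OF nd]) simp
  then show "6 * cmod (W core3 j) \<le> real \<kappa> + (8 - real \<kappa>) * sqrt q"
    using tri b[of 1] b[of 2] by (simp add: left_diff_distrib)
  assume "3 dvd q + 1"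
  then have c: "4 * cmod (?w i) \<le> real \<kappa> + (4 - real \<kappa>) * sqrt q" for i
    using j q_minus_1_dvd_mult_div by (intro W_two_mod_four_bound(2)[OF nd]) simp
  show "6 * cmod (W core3 j) \<le> 2 * real \<kappa> + (8 - 2 * real \<kappa>) * sqrt q"
    using tri c[of 0] c[of 1] c[of 2] by (simp add: left_diff_distrib)
qed

lemma W_core3_0:
  assumes "3 dvd M"
  shows "6 * (\<Sum>a\<in>A. core3 a) \<ge> real q + 1 - real \<kappa> - (8 - real \<kappa>) * sqrt q"
    and "3 dvd q + 1 \<Longrightarrow>
      6 * (\<Sum>a\<in>A. core3 a) \<ge> real q + 1 - 2 * real \<kappa> - (8 - 2 * real \<kappa>) * sqrt q"
proof -
  let ?w = "\<lambda>i. W two_mod_four (i * (M div 3))"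
  have nd: "\<not> M dvd 4 * (i * (M div 3))" if "0 < i" "i < 3" for i
    by (rule not_dvd_mult_div[OF assms _ that]) (simp add: coprime_iff_gcd_eq_1 gcd_non_0_nat)
  have "6 * (\<Sum>a\<in>A. core3 a) = 4 * (\<Sum>a\<in>A. two_mod_four a) - 2 * Re (?w 1) - 2 * Re (?w 2)"
    using W_core3[OF assms, of 0] W_0[of core3] W_0[of two_mod_four]
    by (simp add: complex_eq_iff)
  also have "\<dots> \<ge> 4 * (\<Sum>a\<in>A. two_mod_four a) - 2 * cmod (?w 1) - 2 * cmod (?w 2)"
    using abs_Re_le_cmod[of "?w 1"] abs_Re_le_cmod[of "?w 2"] by linarith
  finally have tri: "6 * (\<Sum>a\<in>A. core3 a) \<ge>
      real q + 1 - real \<kappa> - (4 - real \<kappa>) * sqrt q - 2 * cmod (?w 1) - 2 * cmod (?w 2)"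
    using W_two_mod_four_0 by linarith
  have b: "cmod (?w i) \<le> sqrt q" if "0 < i" "i < 3" for i
    using W_two_mod_four_bound(1)[OF nd[OF that]] .
  show "6 * (\<Sum>a\<in>A. core3 a) \<ge> real q + 1 - real \<kappa> - (8 - real \<kappa>) * sqrt q"
    using tri b[of 1] b[of 2] by (simp add: left_diff_distrib)
  assume "3 dvd q + 1"
  then have c: "4 * cmod (?w i) \<le> real \<kappa> + (4 - real \<kappa>) * sqrt q" if "0 < i" "i < 3" for i
    using q_minus_1_dvd_mult_div by (intro W_two_mod_four_bound(2)[OF nd[OF that]]) simp
  show "6 * (\<Sum>a\<in>A. core3 a) \<ge> real q + 1 - 2 * real \<kappa> - (8 - 2 * real \<kappa>) * sqrt q"
    using tri c[of 1] c[of 2] by (simp add: left_diff_distrib)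
qed

section \<open>The sieve\<close>

lemma sum_dvd_bound:
  assumes "0 < l" "l dvd M" "\<And>k. 0 < k \<Longrightarrow> k < l \<Longrightarrow> cmod (W h (k * (M div l))) \<le> E"
  shows "\<bar>(\<Sum>a\<in>A. h a * of_bool (l dvd a)) - (\<Sum>a\<in>A. h a) / l\<bar> \<le> (1 - 1 / l) * E"
proof -
  let ?s = "\<Sum>k\<in>{..<l} - {0}. W h (k * (M div l))"
  have "complex_of_real (\<Sum>a\<in>A. h a * of_bool (l dvd a)) = W (\<lambda>a. h a * of_bool (l dvd a)) 0"
    by (simp only: W_0)
  also have "\<dots> = (\<Sum>k<l. W h (k * (M div l))) / of_nat l"
    using W_dvd[OF assms(1,2), of h 0] by simp
  also have "(\<Sum>k<l. W h (k * (M div l))) = W h 0 + ?s"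
    using assms(1) by (subst sum.remove[of _ 0]) auto
  finally have eq: "complex_of_real (\<Sum>a\<in>A. h a * of_bool (l dvd a)) = (W h 0 + ?s) / of_nat l" .
  have "complex_of_real ((\<Sum>a\<in>A. h a * of_bool (l dvd a)) - (\<Sum>a\<in>A. h a) / l) = ?s / of_nat l"
    unfolding of_real_diff eq W_0 of_real_divide of_real_of_nat_eq add_divide_distrib
    by (rule add_diff_cancel_left')
  then have "\<bar>(\<Sum>a\<in>A. h a * of_bool (l dvd a)) - (\<Sum>a\<in>A. h a) / l\<bar> = cmod (?s / of_nat l)"
    by (simp only: norm_of_real[symmetric, where 'a = complex])
  also have "\<dots> = cmod ?s / l"
    by (simp only: norm_divide norm_of_nat)
  also have "\<dots> \<le> (\<Sum>k\<in>{..<l} - {0}. cmod (W h (k * (M div l)))) / l"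
    by (intro divide_right_mono norm_sum) simp
  also have "\<dots> \<le> (\<Sum>k\<in>{..<l} - {0}. E) / l"
    using assms(3) by (intro divide_right_mono sum_mono) auto
  also have "\<dots> = (1 - 1 / l) * E"
    using assms(1) by (simp add: card_Diff_singleton field_simps of_nat_diff)
  finally show ?thesis .
qed

text \<open>If every point of positive weight had a divisor in P, the total weight would be at most
  the sum over l of the weight on the multiples of l, and each summand is the total divided by l up
  to an error of (1 - 1/l) E(l).\<close>

lemma sieve:
  assumes h: "\<And>a. 0 \<le> h a" and P: "finite P" "\<And>l. l \<in> P \<Longrightarrow> prime l \<and> l dvd M"
    and E: "\<And>l k. l \<in> P \<Longrightarrow> 0 < k \<Longrightarrow> k < l \<Longrightarrow> cmod (W h (k * (M div l))) \<le> E l"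
    and less: "(\<Sum>l\<in>P. (1 - 1 / real l) * E l) < (\<Sum>a\<in>A. h a) * (1 - (\<Sum>l\<in>P. 1 / real l))"
  shows "\<exists>a\<in>A. 0 < h a \<and> (\<forall>l\<in>P. \<not> l dvd a)"
proof (rule ccontr)
  assume neg: "\<not> ?thesis"
  have "h a \<le> (\<Sum>l\<in>P. h a * of_bool (l dvd a))" if a: "a \<in> A" for a
  proof (cases "0 < h a")
    case True
    then obtain l where l: "l \<in> P" "l dvd a" using neg a by blast
    then have "h a = h a * of_bool (l dvd a)" by simp
    also have "\<dots> \<le> (\<Sum>l\<in>P. h a * of_bool (l dvd a))"
      using l P(1) h by (intro member_le_sum) auto
    finally show ?thesis .
  next
    case False
    then have "h a = 0" using h[of a] by linarith
    then show ?thesis by simp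
  qed
  then have "(\<Sum>a\<in>A. h a) \<le> (\<Sum>a\<in>A. \<Sum>l\<in>P. h a * of_bool (l dvd a))"
    by (rule sum_mono)
  also have "\<dots> = (\<Sum>l\<in>P. \<Sum>a\<in>A. h a * of_bool (l dvd a))"
    by (rule sum.swap)
  also have "\<dots> \<le> (\<Sum>l\<in>P. (\<Sum>a\<in>A. h a) * (1 / real l) + (1 - 1 / real l) * E l)"
  proof (rule sum_mono)
    fix l assume l: "l \<in> P"
    then have "0 < l" "l dvd M" using P prime_gt_0_nat by auto
    from sum_dvd_bound[OF this E[OF l]]
    show "(\<Sum>a\<in>A. h a * of_bool (l dvd a)) \<le> (\<Sum>a\<in>A. h a) * (1 / real l) + (1 - 1 / real l) * E l"
      by simp
  qed
  also have "\<dots> = (\<Sum>a\<in>A. h a) * (\<Sum>l\<in>P. 1 / real l) + (\<Sum>l\<in>P. (1 - 1 / real l) * E l)"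
    by (simp add: sum.distrib sum_distrib_left)
  finally show False using less by (simp add: right_diff_distrib)
qed
end

section \<open>The sieve criterion for the primes of q - 1 and q + 1\<close>

definition recip_sum :: "nat set \<Rightarrow> real" where
  "recip_sum P = (\<Sum>l\<in>P. 1 / real l)"

definition odd_primes :: "nat \<Rightarrow> nat set" where
  "odd_primes n = {l. prime l \<and> odd l \<and> l dvd n}"

lemma finite_odd_primes: "0 < n \<Longrightarrow> finite (odd_primes n)"
  by (rule finite_subset[of _ "{..n}"]) (auto simp: odd_primes_def dvd_imp_le)

text \<open>\<open>P\<close> and \<open>R\<close> are the sieving primes of \<open>q - 1\<close> and \<open>q + 1\<close>. The weight of the sieve, divided by its
  mean, is a combination of characters whose coefficients have absolute values of sum \<open>T\<close>, of which
  \<open>c\<close> belongs to characters that are trivial on \<open>\<bbbF>\<^bsub>q\<^esub>\<close>.\<close>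

definition sieve_crit :: "nat \<Rightarrow> nat \<Rightarrow> nat \<Rightarrow> nat set \<Rightarrow> nat set \<Rightarrow> bool" where
  "sieve_crit q T c P R \<longleftrightarrow> (let Q = sqrt q; \<delta> = 1 - recip_sum P - recip_sum R in
     0 \<le> \<delta> \<and>
     (real (card R) - recip_sum R) * (c + (real T - c) * Q) + (real (card P) - recip_sum P) * (T * Q)
       < \<delta> * (real q + 1 - c - (real T - c) * Q))"

context spectral_set
begin

lemma prime_dvd_M_iff: "prime l \<Longrightarrow> l dvd M \<longleftrightarrow> l dvd q - 1 \<or> l dvd q + 1"
  unfolding M_eq by (rule prime_dvd_mult_iff)

lemma odd_primes_M: "odd_primes M = odd_primes (q - 1) \<union> odd_primes (q + 1)"
  unfolding odd_primes_def using prime_dvd_M_iff by blast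

lemma odd_primes_disjoint: "odd_primes (q - 1) \<inter> odd_primes (q + 1) = {}"
proof -
  have False if "prime l" "odd l" "l dvd q - 1" "l dvd q + 1" for l
  proof -
    have "l dvd (q + 1) - (q - 1)" using that(3,4) by (metis dvd_diff_nat)
    also have "(q + 1) - (q - 1) = 2" using q_gt_1 by simp
    finally have "l = 2" using that(1) primes_dvd_imp_eq two_is_prime_nat by blast
    then show False using that(2) by simp
  qed
  then show ?thesis by (auto simp: odd_primes_def)
qed

text \<open>In the applications 1/v is the mean of the weight, 1/4 or 1/6. All estimates are thus
  multiplied by v, and the trivial character has coefficient 1 in the main term.\<close>

lemma sieve_crit_imp:
  assumes h: "\<And>a. 0 \<le> h a" and v: "0 < v"
    and P: "P \<subseteq> odd_primes (q - 1)" and R: "R \<subseteq> odd_primes (q + 1)"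
    and main: "real q + 1 - c - (real T - c) * sqrt q \<le> v * (\<Sum>a\<in>A. h a)"
    and bP: "\<And>l k. l \<in> P \<Longrightarrow> 0 < k \<Longrightarrow> k < l \<Longrightarrow> v * cmod (W h (k * (M div l))) \<le> T * sqrt q"
    and bR: "\<And>l k. l \<in> R \<Longrightarrow> 0 < k \<Longrightarrow> k < l \<Longrightarrow>
               v * cmod (W h (k * (M div l))) \<le> c + (real T - c) * sqrt q"
    and crit: "sieve_crit q T c P R"
  shows "\<exists>a\<in>A. 0 < h a \<and> (\<forall>l\<in>P \<union> R. \<not> l dvd a)"
proof -
  define E where "E l = (if l \<in> P then T * sqrt q else c + (real T - c) * sqrt q)" for l
  have fin: "finite P" "finite R"
    using P R finite_odd_primes[of "q - 1"] finite_odd_primes[of "q + 1"] q_gt_1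
    by (auto intro: finite_subset)
  have disj: "P \<inter> R = {}" using P R odd_primes_disjoint by blast
  define D where "D = 1 - recip_sum P - recip_sum R"
  have D: "D = 1 - (\<Sum>l\<in>P \<union> R. 1 / real l)"
    using fin disj by (simp add: D_def recip_sum_def sum.union_disjoint)
  have crit': "0 \<le> D" "(real (card R) - recip_sum R) * (c + (real T - c) * sqrt q) + (real (card P) - recip_sum P) * (T * sqrt q)
       < D * (real q + 1 - c - (real T - c) * sqrt q)"
    using crit by (auto simp: sieve_crit_def D_def Let_def)
  have "v * (\<Sum>l\<in>P \<union> R. (1 - 1 / real l) * (E l / v)) = (\<Sum>l\<in>P \<union> R. (1 - 1 / real l) * E l)"
    using v by (simp add: sum_distrib_left)
  also have "\<dots> = (\<Sum>l\<in>P. (1 - 1 / real l) * E l) + (\<Sum>l\<in>R. (1 - 1 / real l) * E l)"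
    using fin disj by (simp add: sum.union_disjoint)
  also have "(\<Sum>l\<in>P. (1 - 1 / real l) * E l) = (\<Sum>l\<in>P. (1 - 1 / real l)) * (T * sqrt q)"
    by (simp add: E_def sum_distrib_right)
  also have "(\<Sum>l\<in>R. (1 - 1 / real l) * E l) = (\<Sum>l\<in>R. (1 - 1 / real l)) * (c + (real T - c) * sqrt q)"
    using disj by (subst sum_distrib_right) (intro sum.cong, auto simp: E_def)
  finally have "v * (\<Sum>l\<in>P \<union> R. (1 - 1 / real l) * (E l / v)) < D * (real q + 1 - c - (real T - c) * sqrt q)"
    using crit' by (simp add: sum_subtractf recip_sum_def)
  also have "\<dots> \<le> D * (v * (\<Sum>a\<in>A. h a))"
    using crit'(1) main by (intro mult_left_mono) auto
  finally have less: "(\<Sum>l\<in>P \<union> R. (1 - 1 / real l) * (E l / v)) < (\<Sum>a\<in>A. h a) * D"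
    using v by (simp add: mult.left_commute mult.commute)
  show ?thesis
  proof (rule sieve[where E = "\<lambda>l. E l / v"])
    fix l assume "l \<in> P \<union> R"
    then show "prime l \<and> l dvd M" using P R odd_primes_M by (auto simp: odd_primes_def)
  next
    fix l k assume "l \<in> P \<union> R" "0 < k" "k < l"
    then show "cmod (W h (k * (M div l))) \<le> E l / v"
      using bP bR v disj by (auto simp: E_def pos_le_divide_eq mult.commute)
  qed (use h fin less D in auto)
qed

text \<open>A prime dividing half of the gcd is either 2, and then 4 divides a, or an odd prime of
  M.\<close>

lemma gcd_eq_2I:
  assumes "a mod 4 = 2" "\<forall>l\<in>odd_primes M. \<not> l dvd a"
  shows "gcd M a = 2"
proof -
  have "2 dvd a" using assms(1) by presburger
  moreover have "2 dvd M" using eight_dvd_M by (rule dvd_trans[rotated]) simp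
  ultimately have "2 dvd gcd M a" by simp
  then obtain g where g: "gcd M a = 2 * g" by blast
  have "g = 1"
  proof (rule ccontr)
    assume "g \<noteq> 1"
    then obtain l where l: "prime l" "l dvd g" using prime_factor_nat by blast
    then have ld: "2 * l dvd M" "2 * l dvd a"
      using g by (metis dvd_trans gcd_dvd1 mult_dvd_mono dvd_refl,
          metis dvd_trans gcd_dvd2 mult_dvd_mono dvd_refl)
    have "l \<noteq> 2"
    proof
      assume "l = 2"
      then have "4 dvd a" using ld(2) by simp
      then show False using assms(1) by auto
    qed
    then have "odd l" using l(1) primes_dvd_imp_eq two_is_prime_nat by blast
    then have "l \<in> odd_primes M" using l(1) ld(1) by (auto simp: odd_primes_def dest: dvd_mult_right)
    then show False using assms(2) ld(2) by (auto dest: dvd_mult_right)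
  qed
  then show ?thesis using g by simp
qed

lemma two_mod_four_nonneg: "0 \<le> two_mod_four a"
  by (simp add: two_mod_four_def)

lemma odd_primesD:
  assumes "l \<in> odd_primes n"
  shows "coprime 4 l" "l \<noteq> 3 \<Longrightarrow> coprime 12 l" "prime l"
proof -
  have l: "prime l" "odd l" using assms by (auto simp: odd_primes_def)
  then show "coprime 4 l" "prime l"
    using coprime_power_left_iff[of 2 2 l] by auto
  then show "coprime 12 l" if "l \<noteq> 3"
    using coprime_mult_left_iff[of 3 4 l] primes_coprime[of 3 l] that by simp
qed

lemma odd_primes_dvd_M:
  "l \<in> odd_primes (q - 1) \<or> l \<in> odd_primes (q + 1) \<Longrightarrow> l dvd M"
  using prime_dvd_M_iff unfolding odd_primes_def by blast

lemma prime_3_nat: "prime (3 :: nat)"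
  by simp

theorem sieve_no_core:
  assumes "sieve_crit q 4 \<kappa> (odd_primes (q - 1)) (odd_primes (q + 1))"
  shows "\<exists>a\<in>A. gcd M a = 2"
proof -
  have "\<exists>a\<in>A. 0 < two_mod_four a \<and> (\<forall>l\<in>odd_primes (q - 1) \<union> odd_primes (q + 1). \<not> l dvd a)"
  proof (rule sieve_crit_imp[where v = 4])
    fix l k assume l: "l \<in> odd_primes (q - 1)" "0 < k" "k < l"
    then have "\<not> M dvd 4 * (k * (M div l))"
      by (intro not_dvd_mult_div) (auto simp: odd_primesD odd_primes_dvd_M)
    from W_two_mod_four_bound(1)[OF this]
    show "4 * cmod (W two_mod_four (k * (M div l))) \<le> real 4 * sqrt q" by simp
  next
    fix l k assume l: "l \<in> odd_primes (q + 1)" "0 < k" "k < l"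
    then have "\<not> M dvd 4 * (k * (M div l))"
      by (intro not_dvd_mult_div) (auto simp: odd_primesD odd_primes_dvd_M)
    moreover have "(q - 1) dvd k * (M div l)"
      using l by (intro q_minus_1_dvd_mult_div) (simp add: odd_primes_def)
    ultimately show "4 * cmod (W two_mod_four (k * (M div l))) \<le> \<kappa> + (real 4 - \<kappa>) * sqrt q"
      using W_two_mod_four_bound(2) by simp
  qed (use assms two_mod_four_nonneg W_two_mod_four_0 in auto)
  then show ?thesis
    using gcd_eq_2I by (auto simp: two_mod_four_def odd_primes_M)
qed

lemma core3_imp:
  assumes "\<exists>a\<in>A. 0 < core3 a \<and> (\<forall>l\<in>P \<union> R. \<not> l dvd a)"
    "odd_primes M \<subseteq> insert 3 (P \<union> R)"
  shows "\<exists>a\<in>A. gcd M a = 2"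
proof -
  obtain a where a: "a \<in> A" "0 < core3 a" "\<forall>l\<in>P \<union> R. \<not> l dvd a" using assms(1) by blast
  then have "a mod 4 = 2" "\<not> 3 dvd a"
    by (auto simp: core3_def two_mod_four_def of_bool_def split: if_splits)
  then show ?thesis using a assms(2) by (intro bexI[of _ a] gcd_eq_2I) auto
qed

theorem sieve_core3_plus:
  assumes "3 dvd q + 1" "sieve_crit q 8 (2 * \<kappa>) (odd_primes (q - 1)) (odd_primes (q + 1) - {3})"
  shows "\<exists>a\<in>A. gcd M a = 2"
proof -
  have d: "3 dvd M" using assms(1) prime_dvd_M_iff[OF prime_3_nat] by blast
  have n3: "3 \<notin> odd_primes (q - 1)"
    using assms(1) odd_primes_disjoint prime_3_nat unfolding odd_primes_def by blast
  have "\<exists>a\<in>A. 0 < core3 a \<and> (\<forall>l\<in>odd_primes (q - 1) \<union> (odd_primes (q + 1) - {3}). \<not> l dvd a)"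
  proof (rule sieve_crit_imp[where v = 6])
    fix l k assume l: "l \<in> odd_primes (q - 1)" "0 < k" "k < l"
    moreover have "l \<noteq> 3" using l n3 by blast
    ultimately have "\<not> M dvd 12 * (k * (M div l))"
      by (intro not_dvd_mult_div) (auto simp: odd_primesD odd_primes_dvd_M)
    from W_core3_bound(1)[OF d this]
    show "6 * cmod (W core3 (k * (M div l))) \<le> real 8 * sqrt q" by simp
  next
    fix l k assume l: "l \<in> odd_primes (q + 1) - {3}" "0 < k" "k < l"
    then have "\<not> M dvd 12 * (k * (M div l))"
      by (intro not_dvd_mult_div) (auto simp: odd_primesD odd_primes_dvd_M)
    moreover have "(q - 1) dvd k * (M div l)"
      using l by (intro q_minus_1_dvd_mult_div) (simp add: odd_primes_def)
    ultimately show "6 * cmod (W core3 (k * (M div l))) \<le> (2 * \<kappa>) + (real 8 - (2 * \<kappa>)) * sqrt q"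
      using W_core3_bound(2)[OF d] assms(1) by simp
  next
    show "real q + 1 - real (2 * \<kappa>) - (real 8 - real (2 * \<kappa>)) * sqrt q \<le> 6 * (\<Sum>a\<in>A. core3 a)"
      using W_core3_0(2)[OF d assms(1)] by simp
  qed (use assms in \<open>auto simp: core3_def two_mod_four_def\<close>)
  then show ?thesis by (rule core3_imp) (auto simp: odd_primes_M)
qed

theorem sieve_core3_minus:
  assumes "3 dvd q - 1" "sieve_crit q 8 \<kappa> (odd_primes (q - 1) - {3}) (odd_primes (q + 1))"
  shows "\<exists>a\<in>A. gcd M a = 2"
proof -
  have d: "3 dvd M" using assms(1) prime_dvd_M_iff[OF prime_3_nat] by blast
  have n3: "3 \<notin> odd_primes (q + 1)"
    using assms(1) odd_primes_disjoint prime_3_nat unfolding odd_primes_def by blast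
  have "\<exists>a\<in>A. 0 < core3 a \<and> (\<forall>l\<in>(odd_primes (q - 1) - {3}) \<union> odd_primes (q + 1). \<not> l dvd a)"
  proof (rule sieve_crit_imp[where v = 6])
    fix l k assume l: "l \<in> odd_primes (q - 1) - {3}" "0 < k" "k < l"
    then have "\<not> M dvd 12 * (k * (M div l))"
      by (intro not_dvd_mult_div) (auto simp: odd_primesD odd_primes_dvd_M)
    from W_core3_bound(1)[OF d this]
    show "6 * cmod (W core3 (k * (M div l))) \<le> real 8 * sqrt q" by simp
  next
    fix l k assume l: "l \<in> odd_primes (q + 1)" "0 < k" "k < l"
    moreover have "l \<noteq> 3" using l n3 by blast
    ultimately have "\<not> M dvd 12 * (k * (M div l))"
      by (intro not_dvd_mult_div) (auto simp: odd_primesD odd_primes_dvd_M)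
    moreover have "(q - 1) dvd k * (M div l)"
      using l by (intro q_minus_1_dvd_mult_div) (simp add: odd_primes_def)
    ultimately show "6 * cmod (W core3 (k * (M div l))) \<le> \<kappa> + (real 8 - \<kappa>) * sqrt q"
      using W_core3_bound(3)[OF d] by simp
  next
    show "real q + 1 - real \<kappa> - (real 8 - real \<kappa>) * sqrt q \<le> 6 * (\<Sum>a\<in>A. core3 a)"
      using W_core3_0(1)[OF d] by simp
  qed (use assms in \<open>auto simp: core3_def two_mod_four_def\<close>)
  then show ?thesis by (rule core3_imp) (auto simp: odd_primes_M)
qed

end

section \<open>Extremal estimates and a cruder criterion\<close>

lemma Prod_primes_dvd:
  assumes "finite P" "\<And>l. l \<in> P \<Longrightarrow> prime l \<and> l dvd n"
  shows "\<Prod>P dvd (n::nat)"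
  using assms
proof (induction P rule: finite_induct)
  case (insert l P)
  have "coprime l (\<Prod>P)"
    using insert by (intro prod_coprime_right) (metis insertCI primes_coprime)
  then show ?case using insert by (simp add: divides_mult)
qed simp

text \<open>An exchange argument: subtract 1/B from every term. What remains is negative for the
  elements of P beyond B and nonnegative on R. P may also have fewer elements than R; the correction
  term is then negative.\<close>

lemma recip_sum_le:
  assumes "finite P" "finite R" "0 < B" "\<And>l. l \<in> P \<Longrightarrow> l \<le> B \<Longrightarrow> l \<in> R"
    "\<And>l. l \<in> R \<Longrightarrow> 0 < l \<and> l \<le> B"
  shows "recip_sum P \<le> recip_sum R + (real (card P) - real (card R)) / B"
proof -
  have "(\<Sum>l\<in>P. 1 / real l - 1 / real B) \<le> (\<Sum>l\<in>P \<inter> R. 1 / real l - 1 / real B)"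
  proof -
    have "(\<Sum>l\<in>P - R. 1 / real l - 1 / real B) \<le> 0"
      using assms(3,4) by (intro sum_nonpos) (force simp: field_simps)
    then show ?thesis
      using sum.Int_Diff[OF assms(1), of "\<lambda>l. 1 / real l - 1 / real B" R] by linarith
  qed
  also have "\<dots> \<le> (\<Sum>l\<in>R. 1 / real l - 1 / real B)"
  proof (intro sum_mono2)
    fix l assume "l \<in> R - P \<inter> R"
    then have "1 / real B \<le> 1 / real l" using assms(5) by (intro frac_le) auto
    then show "0 \<le> 1 / real l - 1 / real B" by simp
  qed (use assms(2) in auto)
  finally show ?thesis
    by (simp add: recip_sum_def sum_subtractf diff_divide_distrib)
qed

text \<open>The same exchange for the factors l/B, which are at most 1 on R and above 1 on P outside
  R.\<close>

lemma prod_ge: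
  fixes P R :: "nat set"
  assumes "finite P" "finite R" "0 < B" "\<And>l. l \<in> P \<Longrightarrow> l \<le> B \<Longrightarrow> l \<in> R"
    "\<And>l. l \<in> R \<Longrightarrow> 0 < l \<and> l \<le> B" "card R \<le> card P"
  shows "\<Prod>R * B ^ (card P - card R) \<le> \<Prod>P"
proof -
  have "(\<Prod>l\<in>R. real l / real B) \<le> (\<Prod>l\<in>P \<inter> R. real l / real B)"
  proof -
    have "(\<Prod>l\<in>R - P. real l / real B) \<le> 1"
      using assms(3,5) by (intro prod_le_1) (auto simp: field_simps)
    moreover have "0 \<le> (\<Prod>l\<in>P \<inter> R. real l / real B)" by (intro prod_nonneg) auto
    ultimately show ?thesis
      using prod.Int_Diff[OF assms(2), of "\<lambda>l. real l / real B" P]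
      by (metis mult_left_le Int_commute)
  qed
  also have "\<dots> \<le> (\<Prod>l\<in>P. real l / real B)"
  proof -
    have "1 \<le> (\<Prod>l\<in>P - R. real l / real B)"
      using assms(3,4) by (intro prod_ge_1) (force simp: field_simps)
    moreover have "0 \<le> (\<Prod>l\<in>P \<inter> R. real l / real B)" by (intro prod_nonneg) auto
    ultimately show ?thesis
      using prod.Int_Diff[OF assms(1), of "\<lambda>l. real l / real B" R]
      by (metis mult_left_mono mult.right_neutral)
  qed
  finally have "(\<Prod>l\<in>R. real l) / real B ^ card R \<le> (\<Prod>l\<in>P. real l) / real B ^ card P"
    by (simp add: prod_dividef)
  moreover have "real B ^ card P = real B ^ card R * real B ^ (card P - card R)"
    using assms(6) by (simp flip: power_add)
  ultimately have "real (\<Prod>R * B ^ (card P - card R)) \<le> real (\<Prod>P)"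
    using assms(3) by (simp add: field_simps)
  then show ?thesis by (simp only: of_nat_le_iff)
qed

lemma recip_sum_le_card:
  assumes "\<And>l. l \<in> P \<Longrightarrow> 0 < l"
  shows "recip_sum P \<le> card P"
proof -
  have "recip_sum P \<le> (\<Sum>l\<in>P. 1)"
    unfolding recip_sum_def using assms by (intro sum_mono) (force simp: field_simps Suc_le_eq)
  then show ?thesis by simp
qed

text \<open>Put Q = sqrt q. Forgetting the gain from characters trivial on F_q means using c + (T -
  c) Q <= T Q and q + 1 - c - (T - c) Q >= q - (T - 1) Q. Since the reciprocals add up to 1 -
  \<delta>, the left side of the criterion becomes T (n - 1 + \<delta>) Q. Cancelling Q and moving T
  \<delta> to the right yields 2 T - 1.\<close>

lemma sieve_crit_crude:
  assumes pos: "\<And>l. l \<in> P \<union> R \<Longrightarrow> 0 < l"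
    and c: "1 \<le> c" and q: "1 \<le> q"
    and \<delta>: "\<delta> = 1 - recip_sum P - recip_sum R" "0 < \<delta>"
    and n: "n = real (card P) + real (card R)"
    and less: "T * (n - 1) < \<delta> * (sqrt q - (2 * real T - 1))"
  shows "sieve_crit q T c P R"
proof -
  have Q: "1 \<le> sqrt q" "sqrt q * sqrt q = q" using q by auto
  have cQ: "0 \<le> (real c - 1) * (sqrt q - 1)" "0 \<le> real c * (sqrt q - 1)"
    using c Q by auto
  have "(real (card R) - recip_sum R) * (c + (real T - c) * sqrt q)
      + (real (card P) - recip_sum P) * (T * sqrt q)
    \<le> (real (card R) - recip_sum R) * (T * sqrt q) + (real (card P) - recip_sum P) * (T * sqrt q)"
    using recip_sum_le_card[of R] pos cQ(2)
    by (intro add_right_mono mult_left_mono) (auto simp: algebra_simps)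
  also have "\<dots> = (T * (n - 1) + T * \<delta>) * sqrt q"
    unfolding n \<delta>(1) by (simp add: algebra_simps)
  also have "\<dots> < (\<delta> * (sqrt q - (2 * real T - 1)) + T * \<delta>) * sqrt q"
    using less Q(1) by (intro mult_strict_right_mono) auto
  also have "\<dots> = \<delta> * (q - (real T - 1) * sqrt q)"
    using Q(2) by (simp add: algebra_simps)
  also have "\<dots> \<le> \<delta> * (real q + 1 - c - (real T - c) * sqrt q)"
    using \<delta>(2) cQ(1) by (intro mult_left_mono) (auto simp: algebra_simps)
  finally show ?thesis
    using \<delta> by (simp add: sieve_crit_def Let_def)
qed

text \<open>The extreme case is {2, ..., m + 1}, where the product telescopes to 1/(m + 1).
  Inserting the elements in increasing order makes each new one at least
  \<open>card C + 2\<close>.\<close>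

lemma prod_one_minus_ge:
  fixes C :: "nat set"
  assumes "finite C" "\<And>l. l \<in> C \<Longrightarrow> 2 \<le> l"
  shows "1 / (real (card C) + 1) \<le> (\<Prod>l\<in>C. 1 - 1 / real l)"
  using assms
proof (induction C rule: finite_linorder_max_induct)
  case empty
  then show ?case by simp
next
  case (insert b C)
  have "insert b C \<subseteq> {2..b}" using insert by fastforce
  then have "card (insert b C) \<le> card {2..b}" by (intro card_mono) auto
  then have b: "card C + 2 \<le> b" using insert by (auto split: if_splits)
  have ih: "1 / (real (card C) + 1) \<le> (\<Prod>l\<in>C. 1 - 1 / real l)" using insert by auto
  have "1 / (real (card C) + 2) = (1 - 1 / (real (card C) + 2)) * (1 / (real (card C) + 1))"
    by (simp add: field_simps)
  also have "\<dots> \<le> (1 - 1 / real b) * (\<Prod>l\<in>C. 1 - 1 / real l)"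
    using b by (intro mult_mono ih) (auto simp: field_simps)
  finally have "1 / (real (card C) + 2) \<le> (1 - 1 / real b) * (\<Prod>l\<in>C. 1 - 1 / real l)" .
  moreover have "b \<notin> C" using insert by auto
  ultimately show ?case using insert.hyps(1) by (simp add: add.commute)
qed

context spectral_set
begin

text \<open>Excluding one more prime l replaces the count for e by its difference with the count for
  \<open>e * l\<close>. Hence e has to be arbitrary in the induction, and the error doubles at each
  step.\<close>

lemma sieve_full_core:
  assumes "finite C" "0 < e" "e * \<Prod>C dvd M" "odd e" "\<And>l. l \<in> C \<Longrightarrow> prime l \<and> odd l \<and> \<not> l dvd e"
  shows "\<bar>(\<Sum>a\<in>A. two_mod_four a * of_bool (e dvd a \<and> (\<forall>l\<in>C. \<not> l dvd a)))
     - (\<Sum>a\<in>A. two_mod_four a) / e * (\<Prod>l\<in>C. 1 - 1 / real l)\<bar> \<le> 2 ^ card C * sqrt q"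
  using assms
proof (induction C arbitrary: e rule: finite_induct)
  case empty
  have "\<bar>(\<Sum>a\<in>A. two_mod_four a * of_bool (e dvd a)) - (\<Sum>a\<in>A. two_mod_four a) / e\<bar>
      \<le> (1 - 1 / e) * sqrt q"
  proof (rule sum_dvd_bound)
    fix k assume k: "0 < k" "k < e"
    have "coprime 4 e" using empty coprime_power_left_iff[of 2 2 e] by auto
    then show "cmod (W two_mod_four (k * (M div e))) \<le> sqrt q"
      using empty k by (intro W_two_mod_four_bound(1) not_dvd_mult_div) auto
  qed (use empty in auto)
  also have "\<dots> \<le> sqrt q" by (simp add: mult_left_le_one_le left_diff_distrib)
  finally show ?case by simp
next
  case (insert l C)
  let ?N = "\<lambda>e. \<Sum>a\<in>A. two_mod_four a * of_bool (e dvd a \<and> (\<forall>l\<in>C. \<not> l dvd a))"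
  let ?G = "\<Sum>a\<in>A. two_mod_four a" and ?\<theta> = "\<Prod>l\<in>C. 1 - 1 / real l"
  have l: "prime l" "odd l" "\<not> l dvd e" using insert.prems by auto
  have cop: "coprime e l" using prime_imp_coprime[OF l(1,3)] by (rule coprime_commute[THEN iffD1])
  have split: "two_mod_four a * of_bool (e dvd a \<and> (\<forall>l\<in>insert l C. \<not> l dvd a)) =
      two_mod_four a * of_bool (e dvd a \<and> (\<forall>l\<in>C. \<not> l dvd a)) -
      two_mod_four a * of_bool (e * l dvd a \<and> (\<forall>l\<in>C. \<not> l dvd a))" for a
  proof -
    have "e * l dvd a \<longleftrightarrow> e dvd a \<and> l dvd a"
      using divides_mult[OF _ _ cop, of a] dvd_mult_left[of e l a] dvd_mult_right[of e l a] by blast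
    then show ?thesis by (auto simp: of_bool_def)
  qed
  have "(\<Sum>a\<in>A. two_mod_four a * of_bool (e dvd a \<and> (\<forall>l\<in>insert l C. \<not> l dvd a))) = ?N e - ?N (e * l)"
    by (simp only: split sum_subtractf)
  moreover have "\<bar>?N e - ?G / e * ?\<theta>\<bar> \<le> 2 ^ card C * sqrt q"
  proof (rule insert.IH)
    have "e * \<Prod>C dvd e * \<Prod>(insert l C)" using insert by simp
    then show "e * \<Prod>C dvd M" using insert.prems(2) dvd_trans by blast
  qed (use insert.prems in auto)
  moreover have "\<bar>?N (e * l) - ?G / (e * l) * ?\<theta>\<bar> \<le> 2 ^ card C * sqrt q"
  proof (rule insert.IH)
    show "e * l * \<Prod>C dvd M" using insert.prems(2) insert.hyps by (simp add: mult.assoc)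
    fix l' assume l': "l' \<in> C"
    then have "l' \<noteq> l" using insert.hyps by auto
    then show "prime l' \<and> odd l' \<and> \<not> l' dvd e * l"
      using insert.prems(4)[of l'] l' l(1) by (auto simp: prime_dvd_mult_iff primes_dvd_imp_eq)
  qed (use insert.prems l in \<open>auto simp: prime_gt_0_nat\<close>)
  moreover have "?G / e * (\<Prod>l\<in>insert l C. 1 - 1 / real l) = ?G / e * ?\<theta> - ?G / (e * l) * ?\<theta>"
    using insert.hyps by (simp add: algebra_simps)
  ultimately show ?case
    using insert.hyps by simp
qed

lemma finite_odd_primes_M: "finite (odd_primes M)"
  using finite_odd_primes M_pos by blast

text \<open>Inclusion-exclusion over all m odd primes costs an error factor 2^m but needs no bound
  on the reciprocal sum: the density is at least 1/(m + 1), and four times the total weight is at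
  least q - 3 sqrt q.\<close>

theorem sieve_tail:
  assumes "4 * 2 ^ card (odd_primes M) * (real (card (odd_primes M)) + 1) + 3 < sqrt q"
  shows "\<exists>a\<in>A. gcd M a = 2"
proof -
  let ?C = "odd_primes M"
  define m where "m = real (card ?C)"
  define G where "G = (\<Sum>a\<in>A. two_mod_four a)"
  define N where "N = (\<Sum>a\<in>A. two_mod_four a * of_bool (1 dvd a \<and> (\<forall>l\<in>?C. \<not> l dvd a)))"
  have Q: "1 \<le> sqrt q" "sqrt q * sqrt q = q" using Q_ge_1 by auto
  have "\<bar>N - G / real 1 * (\<Prod>l\<in>?C. 1 - 1 / real l)\<bar> \<le> 2 ^ card ?C * sqrt q"
    unfolding N_def G_def
    using Prod_primes_dvd[OF finite_odd_primes_M, of M] finite_odd_primes_M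
    by (intro sieve_full_core) (auto simp: odd_primes_def not_prime_1)
  then have N: "G * (\<Prod>l\<in>?C. 1 - 1 / real l) - 2 ^ card ?C * sqrt q \<le> N" by simp
  have "0 \<le> (real \<kappa> - 1) * (sqrt q - 1)"
    using \<kappa>_cases Q(1) by auto
  then have G: "q - 3 * sqrt q \<le> 4 * G"
    using W_two_mod_four_0 unfolding G_def by (simp add: algebra_simps)
  have m: "0 \<le> m" by (simp add: m_def)
  have "0 \<le> 4 * 2 ^ card ?C * (m + 1)" using m by simp
  then have "(3::real) \<le> sqrt q" using assms unfolding m_def by linarith
  then have "3 * sqrt q \<le> q" using Q(2) by (metis mult_right_mono real_sqrt_ge_zero of_nat_0_le_iff)
  then have G0: "0 \<le> G" using G by linarith
  have "(4 * 2 ^ card ?C * (m + 1)) * sqrt q < (sqrt q - 3) * sqrt q"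
    using assms Q(1) unfolding m_def by (intro mult_strict_right_mono) auto
  also have "\<dots> \<le> 4 * G" using G Q(2) by (simp add: algebra_simps)
  finally have "2 ^ card ?C * sqrt q < G * (1 / (m + 1))"
    using m by (simp add: field_simps)
  also have "\<dots> \<le> G * (\<Prod>l\<in>?C. 1 - 1 / real l)"
    unfolding m_def using G0 finite_odd_primes_M
    by (intro mult_left_mono prod_one_minus_ge) (auto simp: odd_primes_def prime_ge_2_nat)
  finally have "0 < N" using N by linarith
  then have "\<exists>a\<in>A. two_mod_four a * of_bool (1 dvd a \<and> (\<forall>l\<in>?C. \<not> l dvd a)) \<noteq> 0"
    unfolding N_def by (metis (no_types, lifting) less_irrefl sum.neutral)
  then obtain a where "a \<in> A" "a mod 4 = 2" "\<forall>l\<in>?C. \<not> l dvd a"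
    by (auto simp: two_mod_four_def)
  then show ?thesis using gcd_eq_2I by blast
qed

definition primes5 where "primes5 = odd_primes M - {3}"

lemma finite_primes5: "finite primes5"
  by (simp add: primes5_def finite_odd_primes_M)

lemma primes5_D: "l \<in> primes5 \<Longrightarrow> prime l \<and> l dvd M \<and> 5 \<le> l"
proof -
  assume "l \<in> primes5"
  then have l: "prime l" "odd l" "l dvd M" "l \<noteq> 3" by (auto simp: primes5_def odd_primes_def)
  then have "2 \<le> l" "l \<noteq> 4" by (auto simp: prime_ge_2_nat)
  then have "5 \<le> l" using l(2,4) by presburger
  then show ?thesis using l by auto
qed

text \<open>In each of the cases 3 divides q + 1, 3 divides q - 1 and 3 does not divide M, the
  sieved primes are exactly \<open>primes5\<close>, and only T differs.\<close>

theorem sieve_crude: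
  assumes \<delta>: "\<delta> \<le> 1 - recip_sum primes5" "0 < \<delta>"
    and n: "real (card primes5) \<le> n" "1 \<le> n"
    and T: "T = (if 3 dvd M then 8 else 4 :: real)"
    and less: "T * (n - 1) < \<delta> * (sqrt q - (2 * T - 1))"
  shows "\<exists>a\<in>A. gcd M a = 2"
proof -
  let ?P = "odd_primes (q - 1)" and ?R = "odd_primes (q + 1)"
  have fin: "finite ?P" "finite ?R" using finite_odd_primes q_gt_1 by auto
  have pos: "0 < l" if "l \<in> ?P \<union> ?R" for l
    using that by (auto simp: odd_primes_def prime_gt_0_nat)
  have "0 \<le> T * (n - 1)" using n T by auto
  then have "0 < \<delta> * (sqrt q - (2 * T - 1))" using less by linarith
  then have Qpos: "0 < sqrt q - (2 * T - 1)" using \<delta>(2) by (simp add: zero_less_mult_iff)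
  have less': "T * (real (card primes5) - 1) < (1 - recip_sum primes5) * (sqrt q - (2 * T - 1))"
  proof -
    have "T * (real (card primes5) - 1) \<le> T * (n - 1)" using n T by (intro mult_left_mono) auto
    also note less
    also have "\<delta> * (sqrt q - (2 * T - 1)) \<le> (1 - recip_sum primes5) * (sqrt q - (2 * T - 1))"
      using \<delta> Qpos by (intro mult_right_mono) auto
    finally show ?thesis .
  qed
  have rU: "recip_sum (X \<union> Y) = recip_sum X + recip_sum Y" "card (X \<union> Y) = card X + card Y"
    if "X \<subseteq> ?P" "Y \<subseteq> ?R" for X Y
  proof -
    have "finite X" "finite Y" "X \<inter> Y = {}"
      using that fin odd_primes_disjoint by (auto intro: finite_subset)
    then show "recip_sum (X \<union> Y) = recip_sum X + recip_sum Y" "card (X \<union> Y) = card X + card Y"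
      by (auto simp: recip_sum_def sum.union_disjoint card_Un_disjoint)
  qed
  have crit: "sieve_crit q (nat \<lfloor>T\<rfloor>) c X Y"
    if "1 \<le> c" "X \<subseteq> ?P" "Y \<subseteq> ?R" "primes5 = X \<union> Y" for c X Y
  proof (rule sieve_crit_crude[OF _ that(1)])
    show "real (nat \<lfloor>T\<rfloor>) * ((real (card X) + real (card Y)) - 1)
      < (1 - recip_sum X - recip_sum Y) * (sqrt q - (2 * real (nat \<lfloor>T\<rfloor>) - 1))"
      using less' rU[OF that(2,3)] that(4) T by (auto simp: diff_diff_eq split: if_splits)
    show "0 < 1 - recip_sum X - recip_sum Y"
      using \<delta> rU[OF that(2,3)] that(4) by simp
    show "0 < l" if "l \<in> X \<union> Y" for l using that pos \<open>X \<subseteq> ?P\<close> \<open>Y \<subseteq> ?R\<close> by blast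
  qed (use q_gt_1 in auto)
  have \<kappa>1: "1 \<le> \<kappa>" "1 \<le> 2 * \<kappa>" using \<kappa>_cases by auto
  have three: "3 dvd n \<longleftrightarrow> 3 \<in> odd_primes n" for n by (simp add: odd_primes_def)
  consider "3 dvd q + 1" | "3 dvd q - 1" | "\<not> 3 dvd M"
    using prime_dvd_M_iff[OF prime_3_nat] by blast
  then show ?thesis
  proof cases
    case 1
    then have "3 dvd M" "3 \<notin> ?P" using prime_dvd_M_iff[OF prime_3_nat] three odd_primes_disjoint by blast+
    then show ?thesis
      using crit[of "2 * \<kappa>" ?P "?R - {3}"] \<kappa>1 T 1
      by (intro sieve_core3_plus) (auto simp: primes5_def odd_primes_M)
  next
    case 2
    then have "3 dvd M" "3 \<notin> ?R" using prime_dvd_M_iff[OF prime_3_nat] three odd_primes_disjoint by blast+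
    then show ?thesis
      using crit[of "\<kappa>" "?P - {3}" "?R"] \<kappa>1 T 2
      by (intro sieve_core3_minus) (auto simp: primes5_def odd_primes_M)
  next
    case 3
    then have "3 \<notin> ?P \<union> ?R" using three odd_primes_M by blast
    then show ?thesis
      using crit[of "\<kappa>" "?P" "?R"] \<kappa>1 T 3
      by (intro sieve_no_core) (auto simp: primes5_def odd_primes_M)
  qed
qed

end

section \<open>Large fields\<close>

definition primes_5_101 :: "nat list" where
  "primes_5_101 = [5, 7, 11, 13, 17, 19, 23, 29, 31, 37, 41, 43, 47, 53, 59, 61, 67, 71, 73, 79,
     83, 89, 97, 101]"

lemma prime_le_101:
  assumes "prime l" "5 \<le> l" "l \<le> 101"
  shows "l \<in> set primes_5_101"
proof -
  \<comment> \<open>Trial divisors up to 7 suffice because 11^2 exceeds 101.\<close>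
  have *: "\<forall>l\<in>set [5..<102]. l \<in> set primes_5_101 \<or> (\<exists>d\<in>{2,3,5,7}. d \<noteq> l \<and> l mod d = 0)"
    unfolding primes_5_101_def by (simp add: upt_rec)
  have "l \<in> set [5..<102]" unfolding set_upt atLeastLessThan_iff using assms by linarith
  from bspec[OF * this] show ?thesis
  proof (elim disjE bexE conjE)
    fix d assume d: "d \<in> {2, 3, 5, 7 :: nat}" "d \<noteq> l" "l mod d = 0"
    then have "d dvd l" "d \<noteq> 1" by auto
    then have "d = l" using assms(1) unfolding prime_nat_iff by blast
    then show ?thesis using d by simp
  qed
qed

lemma (in spectral_set) primes5_recip_sum_le:
  assumes R: "\<And>l. l \<in> R \<Longrightarrow> l \<le> B" "R \<subseteq> set primes_5_101" "0 < B" "B \<le> 101"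
    and RB: "\<forall>l\<in>set primes_5_101. l \<le> B \<longrightarrow> l \<in> R"
  shows "recip_sum primes5 \<le> recip_sum R + (real (card primes5) - real (card R)) / B"
proof (rule recip_sum_le)
  show "finite R" using R(2) finite_subset by blast
  have "\<forall>l\<in>set primes_5_101. 0 < l" by (simp add: primes_5_101_def)
  then show "0 < l \<and> l \<le> B" if "l \<in> R" for l using that R(1)[OF that] R(2) by auto
  show "l \<in> R" if "l \<in> primes5" "l \<le> B" for l
    using prime_le_101[of l] primes5_D[OF that(1)] that(2) R(4) RB by auto
qed (use finite_primes5 R in auto)

lemma (in spectral_set) primes5_prod_ge:
  assumes R: "\<And>l. l \<in> R \<Longrightarrow> l \<le> B" "R \<subseteq> set primes_5_101" "0 < B" "B \<le> 101"
    and RB: "\<forall>l\<in>set primes_5_101. l \<le> B \<longrightarrow> l \<in> R" and "card R \<le> card primes5"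
  shows "\<Prod>R * B ^ (card primes5 - card R) \<le> \<Prod>primes5"
proof (rule prod_ge)
  show "finite R" using R(2) finite_subset by blast
  have "\<forall>l\<in>set primes_5_101. 0 < l" by (simp add: primes_5_101_def)
  then show "0 < l \<and> l \<le> B" if "l \<in> R" for l using that R(1)[OF that] R(2) by auto
  show "l \<in> R" if "l \<in> primes5" "l \<le> B" for l
    using prime_le_101[of l] primes5_D[OF that(1)] that(2) R(4) RB by auto
qed (use finite_primes5 R assms in auto)

context spectral_set
begin

text \<open>In this and the next three bounds the constant is the reciprocal sum of all primes from
  5 to the cut-off, rounded up. Each is therefore nearly sharp when \<open>primes5\<close> has
  exactly as many elements as there are such primes.\<close>

lemma primes5_recip_sum_13: "recip_sum primes5 \<le> 5108 / 10000 + (real (card primes5) - 4) / 13"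
proof -
  have "recip_sum primes5 \<le> recip_sum {5, 7, 11, 13} + (real (card primes5) - real (card {5::nat, 7, 11, 13})) / real 13"
    by (rule primes5_recip_sum_le) (auto simp: primes_5_101_def)
  then show ?thesis by (simp add: recip_sum_def)
qed

lemma primes5_recip_sum_19: "recip_sum primes5 \<le> 62215 / 100000 + (real (card primes5) - 6) / 19"
proof -
  have "recip_sum primes5 \<le> recip_sum {5, 7, 11, 13, 17, 19} + (real (card primes5) - real (card {5::nat, 7, 11, 13, 17, 19})) / real 19"
    by (rule primes5_recip_sum_le) (auto simp: primes_5_101_def)
  then show ?thesis by (simp add: recip_sum_def)
qed

lemma primes5_recip_sum_23: "recip_sum primes5 \<le> 6657 / 10000 + (real (card primes5) - 7) / 23"
proof -
  have "recip_sum primes5 \<le> recip_sum {5, 7, 11, 13, 17, 19, 23} + (real (card primes5) - real (card {5::nat, 7, 11, 13, 17, 19, 23})) / real 23"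
    by (rule primes5_recip_sum_le) (auto simp: primes_5_101_def)
  then show ?thesis by (simp add: recip_sum_def)
qed

lemma primes5_recip_sum_101: "recip_sum primes5 \<le> 9798 / 10000 + (real (card primes5) - 24) / 101"
proof -
  have "recip_sum primes5 \<le> recip_sum (set primes_5_101) + (real (card primes5) - real (card (set primes_5_101))) / real 101"
    by (rule primes5_recip_sum_le) (auto simp: primes_5_101_def)
  then show ?thesis by (simp add: recip_sum_def primes_5_101_def)
qed

lemma primes5_prod_23:
  assumes "7 \<le> card primes5"
  shows "37182145 * 23 ^ (card primes5 - 7) \<le> \<Prod>primes5"
proof -
  have "\<Prod>{5, 7, 11, 13, 17, 19, 23} * 23 ^ (card primes5 - card {5::nat, 7, 11, 13, 17, 19, 23}) \<le> \<Prod>primes5"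
    by (rule primes5_prod_ge) (use assms in \<open>auto simp: primes_5_101_def\<close>)
  moreover have "card {5::nat, 7, 11, 13, 17, 19, 23} = 7" "\<Prod>{5::nat, 7, 11, 13, 17, 19, 23} = 37182145"
    by simp_all
  ultimately show ?thesis by (simp only:)
qed

lemma primes5_prod_101:
  assumes "24 \<le> card primes5"
  shows "38810394059749560150010552813417893845 * 101 ^ (card primes5 - 24) \<le> \<Prod>primes5"
proof -
  have "\<Prod>(set primes_5_101) * 101 ^ (card primes5 - card (set primes_5_101)) \<le> \<Prod>primes5"
    by (rule primes5_prod_ge) (use assms in \<open>auto simp: primes_5_101_def\<close>)
  moreover have "card (set primes_5_101) = 24"
    "\<Prod>(set primes_5_101) = 38810394059749560150010552813417893845"
    by (simp_all add: primes_5_101_def)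
  ultimately show ?thesis by (simp only:)
qed

lemma primes5_prod_less: "8 * \<Prod>primes5 < q\<^sup>2"
  and primes5_prod_less_3: "3 dvd M \<Longrightarrow> 24 * \<Prod>primes5 < q\<^sup>2"
proof -
  have less: "8 * \<Prod>P < q\<^sup>2" if "P \<subseteq> odd_primes M" for P
  proof -
    have fin: "finite P" using that finite_odd_primes_M finite_subset by blast
    have "\<Prod>P dvd M"
      using that by (intro Prod_primes_dvd[OF fin]) (auto simp: odd_primes_def)
    moreover have "coprime 8 (\<Prod>P)"
    proof (rule prod_coprime_right)
      fix l assume "l \<in> P"
      then have "odd l" using that by (auto simp: odd_primes_def)
      then show "coprime 8 l" using coprime_power_left_iff[of 2 3 l] by simp
    qed
    ultimately have "8 * \<Prod>P dvd M" using eight_dvd_M by (simp add: divides_mult)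
    then have "8 * \<Prod>P \<le> M" using M_pos by (rule dvd_imp_le)
    also have "M < q\<^sup>2" using q_gt_1 by (simp add: M_def)
    finally show ?thesis .
  qed
  show "8 * \<Prod>primes5 < q\<^sup>2" by (rule less) (auto simp: primes5_def)
  assume "3 dvd M"
  then have "insert 3 primes5 = odd_primes M" by (auto simp: primes5_def odd_primes_def)
  then have "8 * \<Prod>(insert 3 primes5) < q\<^sup>2" by (intro less) auto
  moreover have "3 \<notin> primes5" by (simp add: primes5_def)
  ultimately show "24 * \<Prod>primes5 < q\<^sup>2" using finite_primes5 by simp
qed

lemma sqrt_q_geI:
  assumes "x * x \<le> q"
  shows "real x \<le> sqrt q"
proof (rule real_le_rsqrt)
  have "real (x * x) \<le> real q" using assms by (simp only: of_nat_le_iff)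
  then show "(real x)\<^sup>2 \<le> real q" by (simp add: power2_eq_square)
qed

lemma sqrt_q_geI':
  assumes "b < q\<^sup>2" "(x * x)\<^sup>2 \<le> b"
  shows "real x \<le> sqrt q"
proof (rule sqrt_q_geI)
  have "(x * x)\<^sup>2 < q\<^sup>2" using assms by linarith
  then show "x * x \<le> q" by (simp add: power2_less_imp_less less_imp_le)
qed

lemma sieve_crude_8:
  assumes "\<delta> \<le> 1 - recip_sum primes5" "0 < \<delta>" "real (card primes5) \<le> n" "1 \<le> n"
    and less: "8 * (n - 1) < \<delta> * (sqrt q - 15)"
  shows "\<exists>a\<in>A. gcd M a = 2"
proof (cases "3 dvd M")
  case True
  show ?thesis by (rule sieve_crude[OF assms(1-4) refl]) (use True less in simp)
next
  case False
  have "4 * (n - 1) \<le> 8 * (n - 1)" using assms by simp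
  also note less
  also have "\<delta> * (sqrt q - 15) \<le> \<delta> * (sqrt q - 7)" using assms by (intro mult_left_mono) auto
  finally show ?thesis by (intro sieve_crude[OF assms(1-4) refl]) (use False in simp)
qed

lemma sieve_crude_4:
  assumes "\<delta> \<le> 1 - recip_sum primes5" "0 < \<delta>" "real (card primes5) \<le> n" "1 \<le> n" "\<not> 3 dvd M"
    and less: "4 * (n - 1) < \<delta> * (sqrt q - 7)"
  shows "\<exists>a\<in>A. gcd M a = 2"
  by (rule sieve_crude[OF assms(1-4) refl]) (use assms in simp)

text \<open>The bound 4104 is the least q with 8 * 3 < 0.4892 (sqrt q - 15), the case of four primes
  besides 2 and 3. The result saves most of the later computation from evaluating the exact
  criterion.\<close>

theorem exists_medium:
  assumes "4104 \<le> q" "card (odd_primes M) \<le> 5"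
  shows "\<exists>a\<in>A. gcd M a = 2"
proof -
  have "6406 / 100 \<le> sqrt q"
  proof (rule real_le_rsqrt)
    have "4104 \<le> real q" using assms(1) by simp
    then show "(6406 / 100)\<^sup>2 \<le> real q" by (simp add: power2_eq_square)
  qed
  note Q = this
  show ?thesis
  proof (cases "3 dvd M")
    case True
    then have "3 \<in> odd_primes M" by (simp add: odd_primes_def)
    then have n: "card primes5 \<le> 4"
      using assms(2) finite_odd_primes_M by (simp add: primes5_def card_Diff_singleton)
    have "(real (card primes5) - 4) / 13 \<le> 0" using n by simp
    then have "4892 / 10000 \<le> 1 - recip_sum primes5" using primes5_recip_sum_13 by linarith
    moreover have "8 * (4 - 1) < 4892 / 10000 * (sqrt q - 15)" using Q by simp
    ultimately show ?thesis using n by (intro sieve_crude_8[of "4892 / 10000" 4]) auto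
  next
    case False
    have n: "card primes5 \<le> 5"
      using assms(2) card_mono[OF finite_odd_primes_M, of primes5] by (auto simp: primes5_def)
    have "(real (card primes5) - 4) / 13 \<le> 1 / 13" using n by simp
    then have "4 / 10 \<le> 1 - recip_sum primes5" using primes5_recip_sum_13 by linarith
    moreover have "4 * (5 - 1) < 4 / 10 * (sqrt q - 7)" using Q by simp
    ultimately show ?thesis using n False by (intro sieve_crude_4[of "4 / 10" 5]) auto
  qed
qed

text \<open>With few primes the hypothesis on q is enough. With more primes \<delta> shrinks, but
  their product forces q to be much larger than assumed.\<close>

theorem exists_large:
  assumes "14610 \<le> q"
  shows "\<exists>a\<in>A. gcd M a = 2"
proof -
  define n where "n = card primes5"
  have Q0: "12087 / 100 \<le> sqrt q"
  proof (rule real_le_rsqrt)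
    have "14610 \<le> real q" using assms by simp
    then show "(12087 / 100)\<^sup>2 \<le> real q" by (simp add: power2_eq_square)
  qed
  have less: "8 * (37182145 * 23 ^ (n - 7)) < q\<^sup>2" if "7 \<le> n"
  proof -
    have "8 * (37182145 * 23 ^ (n - 7)) \<le> 8 * \<Prod>primes5"
      using primes5_prod_23 that unfolding n_def by (intro mult_left_mono) auto
    then show ?thesis using primes5_prod_less by linarith
  qed
  have less3: "24 * (37182145 * 23 ^ (n - 7)) < q\<^sup>2" if "7 \<le> n" "3 dvd M"
  proof -
    have "24 * (37182145 * 23 ^ (n - 7)) \<le> 24 * \<Prod>primes5"
      using primes5_prod_23 that unfolding n_def by (intro mult_left_mono) auto
    then show ?thesis using primes5_prod_less_3[OF that(2)] by linarith
  qed
  \<comment> \<open>Here k counts primes beyond the seven from 5 to 23, whose product is 37182145. A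
    lower bound for q^2 gives one for sqrt q by a fourth root.\<close>
  have Qpow: "real x \<le> sqrt q" if "k + 7 \<le> n" "(x * x)\<^sup>2 \<le> 8 * (37182145 * 23 ^ k)" for x k
  proof (rule sqrt_q_geI'[OF less])
    have "(23::nat) ^ k \<le> 23 ^ (n - 7)" using that(1) by (intro power_increasing) auto
    then show "(x * x)\<^sup>2 \<le> 8 * (37182145 * 23 ^ (n - 7))" using that(2) by linarith
  qed (use that in simp)
  consider "n \<le> 6" | "n = 7" | "n = 8" | "n = 9" | "10 \<le> n" "n \<le> 14" | "15 \<le> n" "n \<le> 25" | "26 \<le> n"
    by linarith
  then show ?thesis
  proof cases
    case 1
    then have "(real (card primes5) - 6) / 19 \<le> 0" by (simp add: n_def)
    then have "37785 / 100000 \<le> 1 - recip_sum primes5" using primes5_recip_sum_19 by linarith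
    moreover have "8 * (6 - 1) < 37785 / 100000 * (sqrt q - 15)" using Q0 by simp
    ultimately show ?thesis using 1 by (intro sieve_crude_8[of "37785 / 100000" 6]) (auto simp: n_def)
  next
    case 2
    then have \<delta>: "3343 / 10000 \<le> 1 - recip_sum primes5" using primes5_recip_sum_23 by (simp add: n_def)
    show ?thesis
    proof (cases "3 dvd M")
      case True
      have "real 170 \<le> sqrt q" by (rule sqrt_q_geI'[OF less3]) (use 2 True in auto)
      then have "8 * (7 - 1) < 3343 / 10000 * (sqrt q - 15)" by simp
      then show ?thesis using 2 \<delta> by (intro sieve_crude_8[of "3343 / 10000" 7]) (auto simp: n_def)
    next
      case False
      have "4 * (7 - 1) < 3343 / 10000 * (sqrt q - 7)" using Q0 by simp
      then show ?thesis using 2 \<delta> False by (intro sieve_crude_4[of "3343 / 10000" 7]) (auto simp: n_def)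
    qed
  next
    case 3
    then have \<delta>: "178 / 1000 \<le> 1 - recip_sum primes5" using primes5_recip_sum_101 by (simp add: n_def)
    show ?thesis
    proof (cases "3 dvd M")
      case True
      have "real 370 \<le> sqrt q" by (rule sqrt_q_geI'[OF less3]) (use 3 True in auto)
      then have "8 * (8 - 1) < 178 / 1000 * (sqrt q - 15)" by simp
      then show ?thesis using 3 \<delta> by (intro sieve_crude_8[of "178 / 1000" 8]) (auto simp: n_def)
    next
      case False
      have "real 280 \<le> sqrt q" by (rule Qpow[of 1]) (use 3 in auto)
      then have "4 * (8 - 1) < 178 / 1000 * (sqrt q - 7)" by simp
      then show ?thesis using 3 \<delta> False by (intro sieve_crude_4[of "178 / 1000" 8]) (auto simp: n_def)
    qed
  next
    case 4
    then have \<delta>: "168 / 1000 \<le> 1 - recip_sum primes5" using primes5_recip_sum_101 by (simp add: n_def)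
    have "real 600 \<le> sqrt q" by (rule Qpow[of 2]) (use 4 in auto)
    then have "8 * (9 - 1) < 168 / 1000 * (sqrt q - 15)" by simp
    then show ?thesis using 4 \<delta> by (intro sieve_crude_8[of "168 / 1000" 9]) (auto simp: n_def)
  next
    case 5
    \<comment> \<open>For a range of n the bound for \<delta> is taken at the upper end and the
      bound for sqrt q at the lower end.\<close>
    then have "(real (card primes5) - 24) / 101 \<le> - 10 / 101" by (simp add: n_def)
    then have \<delta>: "119 / 1000 \<le> 1 - recip_sum primes5" using primes5_recip_sum_101 by linarith
    have "real 1300 \<le> sqrt q" by (rule Qpow[of 3]) (use 5 in auto)
    then have "8 * (14 - 1) < 119 / 1000 * (sqrt q - 15)" by simp
    then show ?thesis using 5 \<delta> by (intro sieve_crude_8[of "119 / 1000" 14]) (auto simp: n_def)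
  next
    case 6
    then have "(real (card primes5) - 24) / 101 \<le> 1 / 101" by (simp add: n_def)
    then have \<delta>: "1 / 100 \<le> 1 - recip_sum primes5" using primes5_recip_sum_101 by linarith
    have "real 60000 \<le> sqrt q" by (rule Qpow[of 8]) (use 6 in auto)
    then have "8 * (25 - 1) < 1 / 100 * (sqrt q - 15)" by simp
    then show ?thesis using 6 \<delta> by (intro sieve_crude_8[of "1 / 100" 25]) (auto simp: n_def)
  next
    case 7
    \<comment> \<open>From n = 27 on the bound for the reciprocal sum exceeds 1, so full
      inclusion-exclusion takes over here. The witness \<open>?x\<close> dominates the left side of
      \<open>sieve_tail\<close> for m <= n + 1: the summand 3 is absorbed by one more 2^(n+1), and 4
      (n + 2) + 1 = 4 n + 9.\<close>
    let ?m = "card (odd_primes M)" and ?x = "2 ^ (n + 1) * (4 * n + 9)"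
    let ?K = "8 * 38810394059749560150010552813417893845 :: nat"
    have "odd_primes M \<subseteq> insert 3 primes5" by (auto simp: primes5_def)
    then have "?m \<le> card (insert 3 primes5)" using finite_primes5 by (intro card_mono) auto
    also have "\<dots> \<le> n + 1" unfolding n_def using card_insert_le_m1 finite_primes5
      by (simp add: card_insert_if)
    finally have m: "?m \<le> n + 1" .
    have "(?x * ?x)\<^sup>2 \<le> ?K * 101 ^ (n - 24)"
      using 7
    proof (induction n rule: dec_induct)
      case base
      show ?case by simp
    next
      case (step n)
      let ?x = "\<lambda>n. 2 ^ (n + 1) * (4 * n + 9) :: nat"
      \<comment> \<open>One more prime multiplies the fourth power by at most 3^4 = 81, while the
        lower bound for the product gains a factor 101.\<close>
      have "?x (Suc n) \<le> 3 * ?x n" by (simp add: algebra_simps)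
      then have "?x (Suc n) * ?x (Suc n) \<le> 3 * ?x n * (3 * ?x n)"
        by (rule mult_le_mono) (rule \<open>?x (Suc n) \<le> 3 * ?x n\<close>)
      then have "(?x (Suc n) * ?x (Suc n))\<^sup>2 \<le> (3 * ?x n * (3 * ?x n))\<^sup>2"
        by (rule power_mono) simp
      also have "\<dots> = 81 * (?x n * ?x n)\<^sup>2" by (simp add: power2_eq_square)
      also have "\<dots> \<le> 101 * (?K * 101 ^ (n - 24))" using step by (intro mult_le_mono) auto
      also have "\<dots> = ?K * 101 ^ (Suc n - 24)"
      proof -
        have "Suc n - 24 = Suc (n - 24)" using step by linarith
        then show ?thesis by (simp only: power_Suc mult.left_commute)
      qed
      finally show ?case .
    qed
    also have "\<dots> \<le> 8 * \<Prod>primes5"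
      using primes5_prod_101 7 by (simp add: n_def)
    finally have x: "real ?x \<le> sqrt q"
      by (intro sqrt_q_geI'[OF primes5_prod_less])
    have "4 * 2 ^ ?m * (real ?m + 1) + 3 \<le> 4 * 2 ^ (n + 1) * (real (n + 1) + 1) + 3"
      using m by (intro add_right_mono mult_mono power_increasing) auto
    also have "\<dots> < 4 * 2 ^ (n + 1) * (real (n + 1) + 1) + 2 ^ (n + 1)"
    proof -
      have "(2::real) ^ 2 \<le> 2 ^ (n + 1)" using 7 by (intro power_increasing) auto
      then show ?thesis by simp
    qed
    also have "\<dots> = real ?x" by (simp add: algebra_simps)
    also note x
    finally show ?thesis by (rule sieve_tail)
  qed
qed

end

section \<open>Small fields\<close>

definition quo_rem :: "nat \<Rightarrow> nat \<Rightarrow> nat \<times> nat" where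
  "quo_rem n d = (n div d, n mod d)"

definition quo_rem_step :: "nat \<Rightarrow> nat \<Rightarrow> nat \<Rightarrow> nat \<times> nat" where
  "quo_rem_step d k r = (if r < d then (2 * k, r) else (2 * k + 1, r - d))"

text \<open>Binary long division: the divisor is doubled until it exceeds n, and on the way back
  each step needs at most one subtraction.\<close>

lemma quo_rem_double:
  assumes "0 < d"
  shows "quo_rem n d = (if n < d then (0, n) else
     (case quo_rem n (2 * d) of (k, r) \<Rightarrow> quo_rem_step d k r))"
proof -
  define k r where "k = n div (2 * d)" and "r = n mod (2 * d)"
  have "2 * d * k + r = n" unfolding k_def r_def by (rule mult_div_mod_eq)
  then have n: "n = r + d * (2 * k)" by (simp add: algebra_simps)
  have r: "r < 2 * d" unfolding r_def using assms by simp
  have qr: "quo_rem n (2 * d) = (k, r)" by (simp add: quo_rem_def k_def r_def)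
  have "quo_rem n d = quo_rem_step d k r"
  proof (cases "r < d")
    case True
    then have "n div d = 2 * k" "n mod d = r" unfolding n using assms by simp_all
    then show ?thesis using True by (simp add: quo_rem_def quo_rem_step_def)
  next
    case False
    then have n': "n = (r - d) + d * (2 * k + 1)" using n by simp
    have "r - d < d" using r False by linarith
    then have "n div d = 2 * k + 1" "n mod d = r - d"
      unfolding n' div_mult_self2[OF assms[THEN less_imp_neq, symmetric]] mod_mult_self2 by simp_all
    then show ?thesis using False by (simp add: quo_rem_def quo_rem_step_def)
  qed
  moreover have "quo_rem n d = (0, n)" if "n < d" using that by (simp add: quo_rem_def)
  ultimately show ?thesis unfolding qr by auto
qed

text \<open>On numerals doubling the divisor just appends a zero bit. Used as a rewrite rule this
  terminates only if the comparison is decided before the recursive call is unfolded.\<close>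

lemma quo_rem_rec:
  "quo_rem n (numeral d) = (if n < numeral d then (0, n) else
     (case quo_rem n (numeral (num.Bit0 d)) of (k, r) \<Rightarrow> quo_rem_step (numeral d) k r))"
proof -
  have double: "(numeral (num.Bit0 d) :: nat) = 2 * numeral d"
    using mult_2[of "numeral d :: nat"] numeral_Bit0[of d, where 'a = nat] by presburger
  show ?thesis unfolding double by (rule quo_rem_double) simp
qed

function remove_factor :: "nat \<Rightarrow> nat \<Rightarrow> nat" where
  "remove_factor n p = (if 1 < p \<and> 0 < n \<and> p dvd n then remove_factor (n div p) p else n)"
  by auto
termination by (relation "measure fst") auto

declare remove_factor.simps [simp del]

lemma remove_factor_1: "remove_factor 1 p = 1"
  by (subst remove_factor.simps) simp

lemma remove_factor_2:
  "remove_factor (numeral (num.Bit0 n)) 2 = remove_factor (numeral n) 2"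
  "remove_factor (numeral (num.Bit1 n)) 2 = numeral (num.Bit1 n)"
  by (subst remove_factor.simps, simp)+

lemma remove_factor_quo_rem:
  assumes "0 < n" "1 < p"
  shows "remove_factor n p =
    (case quo_rem n p of (k, r) \<Rightarrow> if r = 0 then remove_factor k p else n)"
  using assms by (subst remove_factor.simps) (auto simp: quo_rem_def mod_eq_0_iff_dvd)

lemma remove_factor_odd:
  "remove_factor (numeral n) (numeral (num.Bit1 p)) =
    (case quo_rem (numeral n) (numeral (num.Bit1 p)) of
      (k, r) \<Rightarrow> if r = 0 then remove_factor k (numeral (num.Bit1 p)) else numeral n)"
  by (rule remove_factor_quo_rem) simp_all

lemma remove_factor:
  assumes "prime p" "0 < n"
  shows "0 < remove_factor n p \<and> remove_factor n p \<le> n \<and>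
    (\<forall>l. prime l \<longrightarrow> (l dvd remove_factor n p \<longleftrightarrow> l dvd n \<and> l \<noteq> p))"
  using assms(2)
proof (induction n rule: less_induct)
  case (less n)
  have p: "1 < p" using assms(1) prime_gt_1_nat by blast
  show ?case
  proof (cases "p dvd n")
    case True
    then obtain k where k: "n = p * k" by blast
    have kn: "n div p = k" "0 < k" "k < n" using k p less.prems by auto
    have eq: "remove_factor n p = remove_factor k p"
      using True p less.prems kn by (subst remove_factor.simps) simp
    have "l dvd n \<and> l \<noteq> p \<longleftrightarrow> l dvd k \<and> l \<noteq> p" if "prime l" for l
      using that assms(1) unfolding k by (auto simp: prime_dvd_mult_iff primes_dvd_imp_eq)
    then show ?thesis using less.IH[OF kn(3,2)] kn unfolding eq by auto
  next
    case False
    then have "remove_factor n p = n" by (subst remove_factor.simps) simp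
    then show ?thesis using less.prems False by auto
  qed
qed

fun remove_factors :: "nat \<Rightarrow> nat list \<Rightarrow> nat" where
  "remove_factors n [] = n"
| "remove_factors n (p # ps) = remove_factors (remove_factor n p) ps"

lemma remove_factors:
  assumes "\<forall>p\<in>set ps. prime p" "0 < n"
  shows "0 < remove_factors n ps \<and> remove_factors n ps \<le> n \<and>
    (\<forall>l. prime l \<longrightarrow> (l dvd remove_factors n ps \<longleftrightarrow> l dvd n \<and> l \<notin> set ps))"
  using assms
proof (induction ps arbitrary: n)
  case (Cons p ps)
  have "prime p" using Cons.prems by simp
  note r = remove_factor[OF this Cons.prems(2)]
  have "0 < remove_factors (remove_factor n p) ps \<and>
    remove_factors (remove_factor n p) ps \<le> remove_factor n p \<and>
    (\<forall>l. prime l \<longrightarrow> (l dvd remove_factors (remove_factor n p) ps \<longleftrightarrow>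
      l dvd remove_factor n p \<and> l \<notin> set ps))"
    using Cons.prems r by (intro Cons.IH) auto
  then show ?case using r by auto
qed simp

text \<open>The table pairs every trial prime with its least multiple that is not below the number under
  consideration, so that moving on to the next number needs no division.\<close>

fun table_hits :: "nat \<Rightarrow> (nat \<times> nat) list \<Rightarrow> nat list" where
  "table_hits m [] = []"
| "table_hits m ((p, x) # s) = (if x = m then p # table_hits m s else table_hits m s)"

fun table_advance :: "nat \<Rightarrow> (nat \<times> nat) list \<Rightarrow> (nat \<times> nat) list" where
  "table_advance m [] = []"
| "table_advance m ((p, x) # s) =
    (if x = m then (p, x + p) # table_advance m s else (p, x) # table_advance m s)"

fun table_init :: "nat \<Rightarrow> nat list \<Rightarrow> (nat \<times> nat) list" where
  "table_init m [] = []"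
| "table_init m (p # ps) =
    (case quo_rem m p of (k, r) \<Rightarrow> if r = 0 then (p, m) else (p, (k + 1) * p)) # table_init m ps"

definition valid_table :: "nat \<Rightarrow> nat list \<Rightarrow> (nat \<times> nat) list \<Rightarrow> bool" where
  "valid_table m ps s \<longleftrightarrow>
     map fst s = ps \<and> (\<forall>(p, x)\<in>set s. p dvd x \<and> m \<le> x \<and> x < m + p)"

lemma table_init_valid:
  assumes "\<forall>p\<in>set ps. 0 < p"
  shows "valid_table m ps (table_init m ps)"
  using assms
proof (induction ps)
  case (Cons p ps)
  have "p dvd x \<and> m \<le> x \<and> x < m + p"
    if "x = (if m mod p = 0 then m else (m div p + 1) * p)" for x
  proof (cases "m mod p = 0")
    case True
    then show ?thesis using that Cons.prems by auto
  next
    case False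
    define k r where "k = m div p" and "r = m mod p"
    have "k * p + r = m" unfolding k_def r_def by (rule div_mult_mod_eq)
    moreover have "r < p" "0 < r" using Cons.prems False by (auto simp: r_def)
    moreover have "x = k * p + p" using that False by (simp add: k_def)
    moreover have "p dvd k * p + p" by simp
    ultimately show ?thesis by simp
  qed
  then show ?case using Cons by (auto simp: valid_table_def quo_rem_def)
qed (simp add: valid_table_def)

lemma table_advance_valid:
  assumes "valid_table m ps s" "\<forall>p\<in>set ps. 0 < p"
  shows "valid_table (m + 1) ps (table_advance m s)"
  using assms
proof (induction s arbitrary: ps)
  case (Cons y s)
  obtain p x where y: "y = (p, x)" by force
  obtain ps' where ps: "ps = p # ps'" using Cons.prems y by (auto simp: valid_table_def)
  have "valid_table (m + 1) ps' (table_advance m s)"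
    using Cons y ps by (auto simp: valid_table_def)
  then show ?case using Cons.prems unfolding y ps by (auto simp: valid_table_def)
qed (simp add: valid_table_def)

lemma table_hits_eq:
  assumes "valid_table m ps s"
  shows "table_hits m s = filter (\<lambda>p. p dvd m) ps"
  using assms
proof (induction s arbitrary: ps)
  case (Cons y s)
  obtain p x where y: "y = (p, x)" by force
  obtain ps' where ps: "ps = p # ps'" using Cons.prems y by (auto simp: valid_table_def)
  have x: "p dvd x" "m \<le> x" "x < m + p" using Cons.prems y by (auto simp: valid_table_def)
  have "x = m \<longleftrightarrow> p dvd m"
  proof
    assume "p dvd m"
    then have "p dvd x - m" using x by (simp add: dvd_diff_nat)
    moreover have "x - m < p" using x by linarith
    ultimately show "x = m" using x(2) nat_dvd_not_less[of "x - m" p] by linarith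
  qed (use x in simp)
  moreover have "table_hits m s = filter (\<lambda>p. p dvd m) ps'"
    using Cons y ps by (intro Cons.IH) (auto simp: valid_table_def)
  ultimately show ?case unfolding y ps by auto
qed (simp add: valid_table_def)

section \<open>Complete factorisation below 103^2\<close>

definition trial_primes :: "nat list" where
  "trial_primes = 3 # primes_5_101"

lemma trial_primes: "distinct trial_primes" "\<forall>p\<in>set trial_primes. prime p \<and> odd p"
  by (simp_all add: trial_primes_def primes_5_101_def)

lemma trial_primes_pos: "\<forall>p\<in>set trial_primes. 0 < p"
  using trial_primes(2) prime_gt_0_nat by blast

lemma in_trial_primes:
  assumes "prime l" "odd l" "l < 103"
  shows "l \<in> set trial_primes"
proof (cases "l = 3")
  case False
  have "2 \<le> l" using assms(1) prime_ge_2_nat by blast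
  then have "5 \<le> l" "l \<le> 101" using assms(2,3) False by presburger+
  then show ?thesis using prime_le_101[OF assms(1)] by (simp add: trial_primes_def)
qed (simp add: trial_primes_def)

text \<open>A function of its own, so that the cofactor is evaluated as an argument before the body
  duplicates it. \<open>complete_hits\<close>, \<open>scaled_crit\<close> and \<open>margin\<close>
  are split off for the same reason.\<close>

definition snoc_cofactor :: "nat list \<Rightarrow> nat \<Rightarrow> nat list" where
  "snoc_cofactor hs c = (if c = 1 then hs else hs @ [c])"

definition complete_hits :: "nat \<Rightarrow> nat list \<Rightarrow> nat list" where
  "complete_hits m hs = snoc_cofactor hs (remove_factors (remove_factor m 2) hs)"

definition odd_factors :: "nat \<Rightarrow> (nat \<times> nat) list \<Rightarrow> nat list" where
  "odd_factors m s = complete_hits m (table_hits m s)"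

text \<open>Every prime factor of the cofactor is at least 103, and two of them would make it at
  least 103 * 103. So the cofactor is 1 or a prime.\<close>

lemma odd_factors:
  assumes "valid_table m trial_primes s" "0 < m" "m < 103 * 103"
  shows "distinct (odd_factors m s)" "set (odd_factors m s) = odd_primes m"
proof -
  define hs where "hs = filter (\<lambda>p. p dvd m) trial_primes"
  define c where "c = remove_factors (remove_factor m 2) hs"
  have eq: "odd_factors m s = snoc_cofactor hs c"
    unfolding odd_factors_def complete_hits_def table_hits_eq[OF assms(1)] hs_def c_def ..
  have hs: "distinct hs" "\<forall>p\<in>set hs. prime p" "set hs \<subseteq> odd_primes m"
    using trial_primes by (auto simp: hs_def odd_primes_def)
  have r: "0 < remove_factor m 2" "remove_factor m 2 \<le> m"
    "\<And>l. prime l \<Longrightarrow> l dvd remove_factor m 2 \<longleftrightarrow> l dvd m \<and> l \<noteq> 2"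
    using remove_factor[OF two_is_prime_nat assms(2)] by auto
  have c: "0 < c" "c \<le> m" using remove_factors[OF hs(2) r(1)] r(2) unfolding c_def by auto
  have cd: "l dvd c \<longleftrightarrow> l \<in> odd_primes m - set hs" if "prime l" for l
  proof -
    have "l \<noteq> 2 \<longleftrightarrow> odd l" using that primes_dvd_imp_eq[OF two_is_prime_nat that] by auto
    then show ?thesis
      using remove_factors[OF hs(2) r(1)] r(3)[OF that] that
      unfolding c_def odd_primes_def by auto
  qed
  have big: "103 \<le> l" if "prime l" "l dvd c" for l
    using cd[OF that(1)] that in_trial_primes[of l] by (fastforce simp: odd_primes_def hs_def)
  have "prime c" if c1: "c \<noteq> 1"
  proof -
    obtain l where l: "prime l" "l dvd c" using c1 prime_factor_nat by blast
    then obtain e where e: "c = l * e" by blast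
    have "e = 1"
    proof (rule ccontr)
      assume "e \<noteq> 1"
      then obtain k where k: "prime k" "k dvd e" using prime_factor_nat by blast
      then have "103 \<le> k" "k \<le> e" using big[of k] e c by (auto intro: dvd_imp_le)
      then have "103 * 103 \<le> c" unfolding e using big[OF l] by (intro mult_le_mono) auto
      then show False using c assms(3) by linarith
    qed
    then show ?thesis using l e by simp
  qed
  then have split: "odd_primes m = set hs \<union> (if c = 1 then {} else {c})"
  proof -
    have "odd_primes m - set hs = {l. prime l \<and> l dvd c}"
      using cd by (auto simp: odd_primes_def)
    also have "\<dots> = (if c = 1 then {} else {c})"
      using \<open>c \<noteq> 1 \<Longrightarrow> prime c\<close> by (auto simp: primes_dvd_imp_eq)
    finally show ?thesis using hs(3) by blast
  qed
  then show "set (odd_factors m s) = odd_primes m"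
    unfolding eq snoc_cofactor_def by auto
  have "c \<notin> set hs" if "c \<noteq> 1" using cd[of c] \<open>c \<noteq> 1 \<Longrightarrow> prime c\<close> that by auto
  then show "distinct (odd_factors m s)"
    unfolding eq snoc_cofactor_def using hs(1) by auto
qed

text \<open>With \<open>p\<close> the product and \<open>n / p\<close> the reciprocal sum of a list of primes, everything below is
  the sieve criterion multiplied by the two products. The truncated subtractions are harmless: a
  truncation makes the right-hand side of \<open>margin\<close> vanish.\<close>

fun recip_num :: "nat list \<Rightarrow> nat" where
  "recip_num [] = 0"
| "recip_num (x # xs) = x * recip_num xs + prod_list xs"

definition margin :: "nat \<Rightarrow> nat \<Rightarrow> nat \<Rightarrow> bool" where
  "margin q Y X \<longleftrightarrow> Y * Y * q < X * X"

text \<open>Here d is the scaled \<delta>, and a and b are the scaled differences of cardinality and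
  reciprocal sum for q - 1 and q + 1. Collecting the terms with sqrt q on one side leaves Y sqrt q <
  X, which \<open>margin\<close> squares to stay within the integers.\<close>

definition scaled_crit :: "nat \<Rightarrow> nat \<Rightarrow> nat \<Rightarrow> nat \<Rightarrow> nat \<Rightarrow> nat \<Rightarrow> bool" where
  "scaled_crit q T c d a b = margin q ((T - c) * (d + b) + T * a) (d * (q + 1 - c) - c * b)"

definition fraction_crit ::
    "nat \<Rightarrow> nat \<Rightarrow> nat \<Rightarrow> nat \<Rightarrow> nat \<Rightarrow> nat \<Rightarrow> nat \<Rightarrow> nat \<Rightarrow> nat \<Rightarrow> bool" where
  "fraction_crit q T c pA nA lA pB nB lB =
    scaled_crit q T c (pA * pB - (nA * pB + nB * pA)) ((lA * pA - nA) * pB) ((lB * pB - nB) * pA)"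

definition list_crit :: "nat \<Rightarrow> nat \<Rightarrow> nat \<Rightarrow> nat list \<Rightarrow> nat list \<Rightarrow> bool" where
  "list_crit q T c A B = fraction_crit q T c (prod_list A) (recip_num A) (length A)
     (prod_list B) (recip_num B) (length B)"

lemma recip_num_eq:
  assumes "\<forall>x\<in>set xs. 0 < x"
  shows "real (recip_num xs) = real (prod_list xs) * (\<Sum>x\<leftarrow>xs. 1 / real x)"
  using assms by (induction xs) (auto simp: algebra_simps)

lemma recip_sum_eq:
  assumes "distinct xs" "\<forall>x\<in>set xs. 0 < x"
  shows "real (recip_num xs) = real (prod_list xs) * recip_sum (set xs)"
  using assms by (simp add: recip_num_eq recip_sum_def sum_list_distinct_conv_sum_set)

lemma list_crit_imp_sieve_crit:
  assumes "list_crit q T c A B" "distinct A" "distinct B" "c \<le> T"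
    and pos: "\<forall>x\<in>set A. 0 < x" "\<forall>x\<in>set B. 0 < x"
  shows "sieve_crit q T c (set A) (set B)"
proof -
  define rA rB where "rA = recip_sum (set A)" and "rB = recip_sum (set B)"
  define pA pB where "pA = prod_list A" and "pB = prod_list B"
  define d a b where "d = pA * pB - (recip_num A * pB + recip_num B * pA)"
    and "a = (length A * pA - recip_num A) * pB" and "b = (length B * pB - recip_num B) * pA"
  define Y X where "Y = (T - c) * (d + b) + T * a" and "X = d * (q + 1 - c) - c * b"
  define P where "P = real pA * real pB"
  have "pA \<noteq> 0" "pB \<noteq> 0" using pos by (auto simp: pA_def pB_def prod_list_zero_iff)
  then have P: "0 < P" by (simp add: P_def)
  have nA: "real (recip_num A) = pA * rA" and nB: "real (recip_num B) = pB * rB"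
    using recip_sum_eq assms by (auto simp: rA_def rB_def pA_def pB_def)
  have r: "rA \<le> length A" "rB \<le> length B"
    using recip_sum_le_card[of "set A"] recip_sum_le_card[of "set B"] assms
    by (auto simp: rA_def rB_def distinct_card)
  have YX: "Y * Y * q < X * X"
    using assms(1) unfolding list_crit_def fraction_crit_def scaled_crit_def margin_def
      Y_def X_def d_def a_def b_def pA_def pB_def by simp
  then have Xpos: "0 < X" by (cases "X = 0") auto
  have d0: "0 < d" and c: "c \<le> q" and X0: "c * b \<le> d * (q + 1 - c)"
    using Xpos unfolding X_def by (auto intro: gr0I simp: not_le) (metis Suc_leI diff_is_0_eq less_or_eq_imp_le not_less mult_0_right zero_diff less_irrefl)
  have d: "real d = P * (1 - rA - rB)"
  proof -
    have "real d = real (pA * pB) - real (recip_num A * pB + recip_num B * pA)"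
      unfolding d_def using d0 d_def by (intro of_nat_diff) linarith
    then show ?thesis by (simp add: nA nB P_def algebra_simps)
  qed
  have a: "real a = P * (length A - rA)"
  proof -
    have "real (recip_num A) \<le> real (length A * pA)" 
      unfolding nA of_nat_mult mult.commute[of "real (length A)"] using r by (intro mult_left_mono) auto
    then have "recip_num A \<le> length A * pA" by (simp only: of_nat_le_iff)
    then show ?thesis unfolding a_def by (simp add: of_nat_diff nA P_def algebra_simps)
  qed
  have b: "real b = P * (length B - rB)"
  proof -
    have "real (recip_num B) \<le> real (length B * pB)" 
      unfolding nB of_nat_mult mult.commute[of "real (length B)"] using r by (intro mult_left_mono) auto
    then have "recip_num B \<le> length B * pB" by (simp only: of_nat_le_iff)
    then show ?thesis unfolding b_def by (simp add: of_nat_diff nB P_def algebra_simps)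
  qed
  have X: "real X = real d * (real q + 1 - c) - real c * real b"
    unfolding X_def using X0 c by (simp add: of_nat_diff)
  have Y: "real Y = (real T - c) * (real d + real b) + real T * real a"
    unfolding Y_def using assms(4) by (simp add: of_nat_diff)
  have "real Y * sqrt q < X"
  proof (rule power2_less_imp_less)
    have "real (Y * Y * q) < real (X * X)" using YX by (simp only: of_nat_less_iff)
    then show "(real Y * sqrt q)\<^sup>2 < (real X)\<^sup>2"
      unfolding power_mult_distrib by (simp add: power2_eq_square[of "real _"])
  qed simp
  then have "P * ((length B - rB) * (c + (real T - c) * sqrt q) + (length A - rA) * (T * sqrt q))
      < P * ((1 - rA - rB) * (real q + 1 - c - (real T - c) * sqrt q))"
    unfolding X Y d a b by (simp add: algebra_simps)
  then have "(length B - rB) * (c + (real T - c) * sqrt q) + (length A - rA) * (T * sqrt q)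
      < (1 - rA - rB) * (real q + 1 - c - (real T - c) * sqrt q)"
    using P by (simp only: mult_less_cancel_left_pos)
  moreover have "0 \<le> 1 - rA - rB" using d0 d P by (metis less_eq_real_def of_nat_0_less_iff zero_less_mult_pos)
  ultimately show ?thesis
    using assms(2,3) by (simp add: sieve_crit_def Let_def rA_def rB_def distinct_card)
qed

section \<open>The test for a single q\<close>

fun starts_with_3 :: "nat list \<Rightarrow> bool" where
  "starts_with_3 [] = False"
| "starts_with_3 (x # xs) = (x = 3)"

text \<open>The factor lists keep the order of \<open>trial_primes\<close>, so 3 can only be at the
  head. Nested conditionals in place of disjunctions ensure that a further criterion is evaluated
  only after the previous one has failed.\<close>

definition crit_core3 :: "nat \<Rightarrow> nat \<Rightarrow> nat list \<Rightarrow> nat list \<Rightarrow> bool" where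
  "crit_core3 q k A B = (if list_crit q 4 k A B then True
     else if starts_with_3 A then list_crit q 8 k (tl A) B
     else if starts_with_3 B then list_crit q 8 (2 * k) A (tl B) else False)"

text \<open>A certificate that q has two different prime factors. The search stops at the first p
  dividing q: if nothing remains after removing p, then q is a power of p.\<close>

fun proper_factor :: "nat \<Rightarrow> nat list \<Rightarrow> bool" where
  "proper_factor q [] = False"
| "proper_factor q (p # ps) =
    (case quo_rem q p of (k, r) \<Rightarrow>
       if r = 0 then (if remove_factor k p = 1 then False else True) else proper_factor q ps)"

text \<open>The test is run for every odd q, so a q that fails all inequalities must be exceptional
  or recognisably no prime power; the primes up to 29 suffice for this in the range checked. With m
  = (q + 1)/2, \<open>even m\<close> means that q is 3 modulo 4, so that 4 or 2 is the value of
  \<open>\<kappa>\<close>.\<close>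

definition crit :: "nat \<Rightarrow> nat \<Rightarrow> nat list \<Rightarrow> nat list \<Rightarrow> bool" where
  "crit q m A B =
    (if 4104 \<le> q \<and> length A + length B \<le> 5 then True
     else if crit_core3 q (if even m then 4 else 2) A B then True
     else if q \<in> exceptional_set then True
     else proper_factor q [3, 5, 7, 11, 13, 17, 19, 23, 29])"

lemma proper_factor_imp:
  assumes "proper_factor q ps" "\<forall>p\<in>set ps. prime p" "0 < q"
  shows "\<not> primepow q"
  using assms
proof (induction ps)
  case (Cons p ps)
  show ?case
  proof (cases "p dvd q")
    case True
    then obtain k where k: "q = p * k" by blast
    have p: "prime p" using Cons.prems by simp
    then have k0: "q div p = k" "0 < k" using k Cons.prems prime_gt_0_nat by auto
    then have "remove_factor k p \<noteq> 1"
      using Cons.prems True by (auto simp: quo_rem_def split: if_splits)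
    then obtain l where "prime l" "l dvd remove_factor k p" using prime_factor_nat by blast
    then have l: "prime l" "l dvd k" "l \<noteq> p" using remove_factor[OF p k0(2)] by auto
    show ?thesis
    proof
      assume "primepow q"
      then obtain r i where r: "prime r" "q = r ^ i" by (auto simp: primepow_def)
      have "p dvd r ^ i" "l dvd r ^ i" using k l r(2) by auto
      then have "p = r" "l = r"
        using p l(1) r(1) prime_dvd_power primes_dvd_imp_eq by blast+
      then show False using l(3) by simp
    qed
  next
    case False
    then show ?thesis using Cons by (auto simp: quo_rem_def mod_eq_0_iff_dvd)
  qed
qed simp

declare proper_factor.simps [simp del]

lemma (in spectral_set) crit_imp:
  assumes crit: "crit q ((q + 1) div 2) A1 B1"
    and A1: "distinct A1" "set A1 = odd_primes (q - 1)"
    and B1: "distinct B1" "set B1 = odd_primes (q + 1)"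
    and q: "q \<notin> exceptional_set" "primepow q"
  shows "\<exists>a\<in>A. gcd M a = 2"
proof -
  have pos: "\<forall>x\<in>set A1. 0 < x" "\<forall>x\<in>set B1. 0 < x"
    using A1 B1 by (auto simp: odd_primes_def prime_gt_0_nat)
  have k: "(if even ((q + 1) div 2) then 4 else 2) = \<kappa>"
  proof -
    have "even ((q + 1) div 2) \<longleftrightarrow> q mod 4 = 3" using q_odd by presburger
    then show ?thesis by (simp add: \<kappa>_def)
  qed
  have k4: "\<kappa> \<le> 4" using \<kappa>_cases by auto
  have "\<not> proper_factor q [3, 5, 7, 11, 13, 17, 19, 23, 29]"
  proof
    assume "proper_factor q [3, 5, 7, 11, 13, 17, 19, 23, 29]"
    then have "\<not> primepow q" by (rule proper_factor_imp) (use q_gt_1 in simp_all)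
    then show False using q(2) by (rule notE)
  qed
  then have "4104 \<le> q \<and> length A1 + length B1 \<le> 5 \<or> crit_core3 q \<kappa> A1 B1"
    using crit q(1) unfolding crit_def k by presburger
  then consider "4104 \<le> q" "length A1 + length B1 \<le> 5" | "crit_core3 q \<kappa> A1 B1"
    by (elim disjE conjE)
  then show ?thesis
  proof cases
    case 1
    have "card (odd_primes M) \<le> card (set A1) + card (set B1)"
      unfolding odd_primes_M A1(2)[symmetric] B1(2)[symmetric] by (rule card_Un_le)
    then show ?thesis
      using 1 A1(1) B1(1) by (intro exists_medium) (auto simp: distinct_card)
  next
    case 2
    then consider "list_crit q 4 \<kappa> A1 B1" | "starts_with_3 A1" "list_crit q 8 \<kappa> (tl A1) B1"
      | "starts_with_3 B1" "list_crit q 8 (2 * \<kappa>) A1 (tl B1)"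
      by (auto simp: crit_core3_def split: if_splits)
    then show ?thesis
    proof cases
      case 1
      then show ?thesis
        using list_crit_imp_sieve_crit[OF 1 A1(1) B1(1) k4 pos] sieve_no_core A1 B1 by simp
    next
      case 2
      then obtain xs where xs: "A1 = 3 # xs" by (cases A1) auto
      then have "set (tl A1) = odd_primes (q - 1) - {3}" "distinct (tl A1)" "3 \<in> odd_primes (q - 1)"
        using A1 by auto
      then show ?thesis
        using list_crit_imp_sieve_crit[OF 2(2) _ B1(1)] k4 pos B1(2) xs
        by (intro sieve_core3_minus) (auto simp: odd_primes_def)
    next
      case 3
      then obtain xs where xs: "B1 = 3 # xs" by (cases B1) auto
      then have "set (tl B1) = odd_primes (q + 1) - {3}" "distinct (tl B1)" "3 \<in> odd_primes (q + 1)"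
        using B1 by auto
      then show ?thesis
        using list_crit_imp_sieve_crit[OF 3(2) A1(1)] k4 pos A1(2) xs
        by (intro sieve_core3_plus) (auto simp: odd_primes_def)
    qed
  qed
qed

text \<open>In \<open>crit_range hi q m s A B\<close> we have \<open>m = (q + 1) / 2\<close>, the table \<open>s\<close> is valid for \<open>m + 1\<close>, and
  \<open>A\<close> and \<open>B\<close> list the odd primes of \<open>q - 1\<close> and \<open>q + 1\<close>; the latter serve again for \<open>q + 2\<close>.\<close>

function crit_range ::
    "nat \<Rightarrow> nat \<Rightarrow> nat \<Rightarrow> (nat \<times> nat) list \<Rightarrow> nat list \<Rightarrow> nat list \<Rightarrow> bool" where
  "crit_range hi q m s A B = (if hi \<le> q then True
     else if crit q m A B
     then crit_range hi (q + 2) (m + 1) (table_advance (m + 1) s) B (odd_factors (m + 1) s)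
     else False)"
  by auto
termination by (relation "measure (\<lambda>(hi, q, _). hi - q)") auto

declare crit_range.simps [simp del]

definition crit_holds :: "nat \<Rightarrow> bool" where
  "crit_holds q \<longleftrightarrow> (\<exists>A B. distinct A \<and> set A = odd_primes (q - 1) \<and>
     distinct B \<and> set B = odd_primes (q + 1) \<and> crit q ((q + 1) div 2) A B)"

text \<open>This allows factoring (q - 1)/2 and (q + 1)/2 instead, which stay below 103^2 throughout
  the range.\<close>

lemma odd_primes_double: "odd_primes (2 * n) = odd_primes n"
  by (auto simp: odd_primes_def prime_dvd_mult_iff dest: primes_dvd_imp_eq[OF _ two_is_prime_nat])

lemma crit_range_imp:
  assumes "crit_range hi q m s A B" "q + 1 = 2 * m" "valid_table (m + 1) trial_primes s"
    "distinct A" "set A = odd_primes (q - 1)" "distinct B" "set B = odd_primes (q + 1)"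
    "hi \<le> 20000" "q \<le> x" "x < hi" "odd x"
  shows "crit_holds x"
  using assms
proof (induction hi q m s A B rule: crit_range.induct)
  case (1 hi q m s A B)
  have c: "crit q m A B"
    "crit_range hi (q + 2) (m + 1) (table_advance (m + 1) s) B (odd_factors (m + 1) s)"
    using 1(2,10,11) crit_range.simps[of hi q m s A B] by (auto split: if_splits)
  show ?case
  proof (cases "x = q")
    case True
    have "m = (q + 1) div 2" using 1(3) by simp
    then show ?thesis using True c(1) 1(5-8) unfolding crit_holds_def by auto
  next
    case False
    have "m + 1 < 10609" using 1(3,9,10,11) by linarith
    then have m: "0 < m + 1" "m + 1 < 103 * 103" by simp_all
    have "q \<noteq> x" "odd q" using False 1(3) by presburger+
    then have x: "q + 2 \<le> x" using 1(10,12) by presburger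
    have e: "(q + 2) + 1 = 2 * (m + 1)" "(q + 2) - 1 = q + 1" using 1(3) by auto
    show ?thesis
    proof (rule 1(1))
      show "set B = odd_primes ((q + 2) - 1)" using 1(8) e(2) by simp
      show "set (odd_factors (m + 1) s) = odd_primes ((q + 2) + 1)"
        unfolding e(1) odd_primes_double using odd_factors(2)[OF 1(4) m] .
      show "\<not> hi \<le> q" using 1(10,11) by simp
    qed (fact c e(1) 1(6,7,9,11,12) x odd_factors(1)[OF 1(4) m]
        table_advance_valid[OF 1(4) trial_primes_pos])+
  qed
qed

text \<open>As with \<open>snoc_cofactor\<close>, the initial tables and lists are passed as
  arguments so that each is computed only once.\<close>

definition range_from_lists ::
    "nat \<Rightarrow> nat \<Rightarrow> nat \<Rightarrow> (nat \<times> nat) list \<Rightarrow> nat list \<Rightarrow> (nat \<times> nat) list \<Rightarrow> bool" where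
  "range_from_lists hi q m s1 A s = crit_range hi q m s A (odd_factors m s1)"

definition range_from_tables ::
    "nat \<Rightarrow> nat \<Rightarrow> nat \<Rightarrow> (nat \<times> nat) list \<Rightarrow> nat \<Rightarrow> (nat \<times> nat) list \<Rightarrow> bool" where
  "range_from_tables hi q m0 s0 m s1 = range_from_lists hi q m s1 (odd_factors m0 s0) (table_advance m s1)"

definition check_range :: "nat \<Rightarrow> nat \<Rightarrow> nat \<Rightarrow> nat \<Rightarrow> bool" where
  "check_range hi q m0 m =
    range_from_tables hi q m0 (table_init m0 trial_primes) m (table_init m trial_primes)"

lemma check_range_imp:
  assumes "check_range hi q m0 m" "q = 2 * m0 + 1" "m = m0 + 1" "0 < m0" "hi \<le> 20000"
    "q \<le> x" "x < hi" "odd x"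
  shows "crit_holds x"
proof -
  have "0 < m" "m < 10609" "m0 < 10609" using assms by linarith+
  then have m: "0 < m" "m < 103 * 103" "m0 < 103 * 103" by simp_all
  have v: "valid_table m0 trial_primes (table_init m0 trial_primes)"
    "valid_table m trial_primes (table_init m trial_primes)"
    using table_init_valid[OF trial_primes_pos] by auto
  have q: "q - 1 = 2 * m0" "q + 1 = 2 * m" using assms by auto
  show ?thesis
  proof (rule crit_range_imp)
    show "crit_range hi q m (table_advance m (table_init m trial_primes))
       (odd_factors m0 (table_init m0 trial_primes)) (odd_factors m (table_init m trial_primes))"
      using assms(1) by (simp add: check_range_def range_from_tables_def range_from_lists_def)
    show "valid_table (m + 1) trial_primes (table_advance m (table_init m trial_primes))"
      by (rule table_advance_valid[OF v(2) trial_primes_pos])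
    show "set (odd_factors m0 (table_init m0 trial_primes)) = odd_primes (q - 1)"
      unfolding q odd_primes_double using odd_factors(2)[OF v(1)] assms m by simp
    show "set (odd_factors m (table_init m trial_primes)) = odd_primes (q + 1)"
      unfolding q odd_primes_double using odd_factors(2)[OF v(2)] m by simp
  qed (use assms m q odd_factors(1)[OF v(1)] odd_factors(1)[OF v(2)] in auto)
qed

section \<open>Numerical verification below 14610\<close>

lemma length_Cons_add: "length (x # xs) = length xs + 1"
  by simp

lemma nat_one: "nat 1 = 1"
  by simp

lemma nat_diff_one:
  "numeral (num.Bit0 n) - 1 = (numeral (Num.BitM n) :: nat)"
  "numeral (num.Bit1 n) - 1 = (numeral (num.Bit0 n) :: nat)"
  "1 - numeral n = (0 :: nat)"
  by (simp_all flip: numeral_plus_one add: numeral_BitM)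

lemmas numeral_eval = arith_simps rel_simps diff_nat_numeral nat_numeral nat_0 nat_one
  numeral_One one_add_one numeral_plus_one one_plus_numeral zero_neq_numeral numeral_neq_zero
  add_0 add_0_right mult_zero_left mult_zero_right mult_1_left mult_1_right diff_0_eq_0 diff_zero diff_self_eq_0
  nat_diff_one Num.BitM.simps
  even_numeral odd_numeral if_True if_False simp_thms

lemmas crit_eval = check_range_def range_from_tables_def range_from_lists_def crit_range.simps
  crit_def crit_core3_def starts_with_3.simps proper_factor.simps list_crit_def fraction_crit_def
  scaled_crit_def margin_def recip_num.simps prod_list.Nil prod_list.Cons list.size(3)
  length_Cons_add odd_factors_def complete_hits_def snoc_cofactor_def remove_factors.simps
  table_init.simps table_advance.simps table_hits.simps remove_factor_1 remove_factor_2
  remove_factor_odd quo_rem_rec quo_rem_step_def append.simps list.sel prod.case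
  trial_primes_def primes_5_101_def exceptional_set_def insert_iff empty_iff

definition crit_holds_below :: "nat \<Rightarrow> bool" where
  "crit_holds_below n \<longleftrightarrow> (\<forall>x. 3 \<le> x \<longrightarrow> x < n \<longrightarrow> odd x \<longrightarrow> crit_holds x)"

lemma crit_holds_below_extend:
  assumes "crit_holds_below q" "check_range hi q m0 m" "q = 2 * m0 + 1" "m = m0 + 1" "0 < m0"
    "hi \<le> 20000"
  shows "crit_holds_below hi"
  unfolding crit_holds_below_def
proof (intro allI impI)
  fix x assume x: "3 \<le> x" "x < hi" "odd x"
  show "crit_holds x"
  proof (cases "x < q")
    case True
    then show ?thesis using assms(1) x unfolding crit_holds_below_def by blast
  next
    case False
    then show ?thesis using check_range_imp[OF assms(2-6) _ x(2,3)] by simp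
  qed
qed

text \<open>With \<open>if_weak_cong\<close> only the condition of a conditional is rewritten until
  it is decided, so the recursive equations unfold along the branch taken and nowhere else. Each
  block starts from fresh tables and is independent of the others.\<close>

lemma check_range_3: "check_range 1001 3 1 2"
  by (simp only: crit_eval numeral_eval cong: if_weak_cong)

lemma check_range_1001: "check_range 2001 1001 500 501"
  by (simp only: crit_eval numeral_eval cong: if_weak_cong)

lemma check_range_2001: "check_range 3001 2001 1000 1001"
  by (simp only: crit_eval numeral_eval cong: if_weak_cong)

lemma check_range_3001: "check_range 4001 3001 1500 1501"
  by (simp only: crit_eval numeral_eval cong: if_weak_cong)

lemma check_range_4001: "check_range 5001 4001 2000 2001"
  by (simp only: crit_eval numeral_eval cong: if_weak_cong)

lemma check_range_5001: "check_range 6001 5001 2500 2501"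
  by (simp only: crit_eval numeral_eval cong: if_weak_cong)

lemma check_range_6001: "check_range 7001 6001 3000 3001"
  by (simp only: crit_eval numeral_eval cong: if_weak_cong)

lemma check_range_7001: "check_range 8001 7001 3500 3501"
  by (simp only: crit_eval numeral_eval cong: if_weak_cong)

lemma check_range_8001: "check_range 9001 8001 4000 4001"
  by (simp only: crit_eval numeral_eval cong: if_weak_cong)

lemma check_range_9001: "check_range 10001 9001 4500 4501"
  by (simp only: crit_eval numeral_eval cong: if_weak_cong)

lemma check_range_10001: "check_range 11001 10001 5000 5001"
  by (simp only: crit_eval numeral_eval cong: if_weak_cong)

lemma check_range_11001: "check_range 12001 11001 5500 5501"
  by (simp only: crit_eval numeral_eval cong: if_weak_cong)

lemma check_range_12001: "check_range 13001 12001 6000 6001"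
  by (simp only: crit_eval numeral_eval cong: if_weak_cong)

lemma check_range_13001: "check_range 14001 13001 6500 6501"
  by (simp only: crit_eval numeral_eval cong: if_weak_cong)

lemma check_range_14001: "check_range 14610 14001 7000 7001"
  by (simp only: crit_eval numeral_eval cong: if_weak_cong)

lemma crit_holds_small:
  assumes "3 \<le> x" "x < 14610" "odd x"
  shows "crit_holds x"
proof -
  have "crit_holds_below 3" by (simp add: crit_holds_below_def)
  from crit_holds_below_extend[OF this check_range_3] have "crit_holds_below 1001" by simp
  from crit_holds_below_extend[OF this check_range_1001] have "crit_holds_below 2001" by simp
  from crit_holds_below_extend[OF this check_range_2001] have "crit_holds_below 3001" by simp
  from crit_holds_below_extend[OF this check_range_3001] have "crit_holds_below 4001" by simp
  from crit_holds_below_extend[OF this check_range_4001] have "crit_holds_below 5001" by simp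
  from crit_holds_below_extend[OF this check_range_5001] have "crit_holds_below 6001" by simp
  from crit_holds_below_extend[OF this check_range_6001] have "crit_holds_below 7001" by simp
  from crit_holds_below_extend[OF this check_range_7001] have "crit_holds_below 8001" by simp
  from crit_holds_below_extend[OF this check_range_8001] have "crit_holds_below 9001" by simp
  from crit_holds_below_extend[OF this check_range_9001] have "crit_holds_below 10001" by simp
  from crit_holds_below_extend[OF this check_range_10001] have "crit_holds_below 11001" by simp
  from crit_holds_below_extend[OF this check_range_11001] have "crit_holds_below 12001" by simp
  from crit_holds_below_extend[OF this check_range_12001] have "crit_holds_below 13001" by simp
  from crit_holds_below_extend[OF this check_range_13001] have "crit_holds_below 14001" by simp
  from crit_holds_below_extend[OF this check_range_14001] have "crit_holds_below 14610" by simp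
  then show ?thesis using assms by (simp add: crit_holds_below_def)
qed

section \<open>Elements of given trace\<close>

lemma card_offdiag:
  assumes "finite A"
  shows "card {(a, b). a \<in> A \<and> b \<in> A \<and> a \<noteq> b} = card A * card A - card A"
proof -
  have "{(a, b). a \<in> A \<and> b \<in> A \<and> a \<noteq> b} = A \<times> A - (\<lambda>a. (a, a)) ` A" by auto
  also have "card \<dots> = card (A \<times> A) - card ((\<lambda>a. (a, a)) ` A)"
    using assms by (intro card_Diff_subset) auto
  also have "card ((\<lambda>a. (a, a)) ` A) = card A"
    by (intro card_image) (auto simp: inj_on_def)
  finally show ?thesis by (simp add: card_cartesian_product)
qed

lemma multiples_below:
  fixes m n :: nat
  assumes "0 < m"
  shows "{k. k < n * m \<and> m dvd k} = (\<lambda>i. i * m) ` {..<n}"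
  using assms by (auto elim!: dvdE simp: mult.commute[of m])

section \<open>The Frobenius map in a commutative ring\<close>

lemma (in cring) binomial:
  assumes x: "x \<in> carrier R" and y: "y \<in> carrier R"
  shows "(x \<oplus> y) [^] (n::nat) = (\<Oplus>k\<in>{..n}. [(n choose k)] \<cdot> (x [^] k \<otimes> y [^] (n - k)))"
proof (induction n)
  case 0
  show ?case using x y by simp
next
  case (Suc n)
  let ?S = "\<Oplus>k\<in>{..n}. [(n choose k)] \<cdot> (x [^] k \<otimes> y [^] (n - k))"
  have Sx: "?S \<otimes> x = (\<Oplus>k\<in>{..n}. [(n choose k)] \<cdot> (x [^] Suc k \<otimes> y [^] (n - k)))"
    using x y by (subst finsum_ldistr)
      (auto intro!: finsum_cong' simp: add_pow_ldistr add_pow_rdistr m_ac)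
  have Sy: "?S \<otimes> y = (\<Oplus>k\<in>{..n}. [(n choose k)] \<cdot> (x [^] k \<otimes> y [^] (Suc n - k)))"
    using x y by (subst finsum_ldistr)
      (auto intro!: finsum_cong' simp: add_pow_ldistr add_pow_rdistr m_ac Suc_diff_le)
  have "(\<Oplus>k\<in>{..Suc n}. [(Suc n choose k)] \<cdot> (x [^] k \<otimes> y [^] (Suc n - k))) =
      (\<Oplus>k\<in>{..n}. [(Suc n choose Suc k)] \<cdot> (x [^] Suc k \<otimes> y [^] (n - k))) \<oplus> y [^] Suc n"
    using x y by (subst finsum_Suc2) auto
  also have "(\<Oplus>k\<in>{..n}. [(Suc n choose Suc k)] \<cdot> (x [^] Suc k \<otimes> y [^] (n - k))) =
      (\<Oplus>k\<in>{..n}. [(n choose k)] \<cdot> (x [^] Suc k \<otimes> y [^] (n - k)) \<oplus>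
        [(n choose Suc k)] \<cdot> (x [^] Suc k \<otimes> y [^] (n - k)))"
    using x y by (intro finsum_cong') (auto simp: add.nat_pow_mult)
  also have "\<dots> = ?S \<otimes> x \<oplus> (\<Oplus>k\<in>{..n}. [(n choose Suc k)] \<cdot> (x [^] Suc k \<otimes> y [^] (n - k)))"
    using x y unfolding Sx by (subst finsum_addf) auto
  also have "\<dots> \<oplus> y [^] Suc n = ?S \<otimes> x \<oplus>
      ((\<Oplus>k\<in>{..n}. [(n choose Suc k)] \<cdot> (x [^] Suc k \<otimes> y [^] (n - k))) \<oplus> y [^] Suc n)"
    using x y by (intro a_assoc) (auto intro!: finsum_closed)
  also have "(\<Oplus>k\<in>{..n}. [(n choose Suc k)] \<cdot> (x [^] Suc k \<otimes> y [^] (n - k))) \<oplus> y [^] Suc n =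
      (\<Oplus>k\<in>{..Suc n}. [(n choose k)] \<cdot> (x [^] k \<otimes> y [^] (Suc n - k)))"
    using x y by (subst finsum_Suc2) auto
  also have "\<dots> = ?S \<otimes> y"
    unfolding Sy using x y by (subst finsum_Suc) (auto simp: binomial_eq_0)
  also have "?S \<otimes> x \<oplus> ?S \<otimes> y = ?S \<otimes> (x \<oplus> y)"
    using x y by (intro r_distr[symmetric]) (auto intro!: finsum_closed)
  finally show ?case using Suc x y by simp
qed

lemma (in cring) add_pow_mult_one:
  "[(m * n :: nat)] \<cdot> \<one> = ([m] \<cdot> \<one>) \<otimes> ([n] \<cdot> \<one>)"
  by (simp add: add_pow_ldistr add.nat_pow_pow mult.commute)

lemma (in cring) add_pow_eq_zero:
  assumes "[p] \<cdot> \<one> = \<zero>" "(p::nat) dvd n" "x \<in> carrier R"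
  shows "[n] \<cdot> x = \<zero>"
proof -
  have "[n] \<cdot> x = ([n] \<cdot> \<one>) \<otimes> x" using assms by (simp add: add_pow_ldistr)
  also have "[n] \<cdot> \<one> = \<zero>"
    using assms(1,2) add_pow_mult_one by (auto elim!: dvdE)
  finally show ?thesis using assms by simp
qed

lemma (in cring) freshmans_dream:
  fixes p :: nat
  assumes p: "prime p" "[p] \<cdot> \<one> = \<zero>" and x: "x \<in> carrier R" and y: "y \<in> carrier R"
  shows "(x \<oplus> y) [^] p = x [^] p \<oplus> y [^] p"
proof -
  obtain m where m: "p = Suc (Suc m)"
    using prime_ge_2_nat[OF p(1)] by (metis Suc_le_D numeral_2_eq_2 Suc_le_mono)
  have "(\<Oplus>k\<in>{..m}. [(p choose Suc k)] \<cdot> (x [^] Suc k \<otimes> y [^] (p - Suc k))) = (\<Oplus>k\<in>{..m}. \<zero>)"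
  proof (rule finsum_cong')
    fix k assume "k \<in> {..m}"
    then have "Suc k \<noteq> p" "Suc k < p" "p \<noteq> 0" using m by auto
    then have "p dvd p choose Suc k"
      using dvd_choose_prime[OF _ _ _ p(1), of "Suc k"] by blast
    then show "[(p choose Suc k)] \<cdot> (x [^] Suc k \<otimes> y [^] (p - Suc k)) = \<zero>"
      by (rule add_pow_eq_zero[OF p(2)]) (intro m_closed nat_pow_closed x y)
  qed auto
  then show ?thesis
    using x y unfolding binomial[OF x y] m
    by (subst finsum_Suc, force, subst finsum_Suc2) (auto simp: a_ac)
qed

lemma (in cring) freshmans_dream_power:
  fixes p :: nat
  assumes p: "prime p" "[p] \<cdot> \<one> = \<zero>" and x: "x \<in> carrier R" and y: "y \<in> carrier R"
  shows "(x \<oplus> y) [^] (p ^ i) = x [^] (p ^ i) \<oplus> y [^] (p ^ i)"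
proof (induction i)
  case (Suc i)
  have "(x \<oplus> y) [^] (p ^ Suc i) = ((x \<oplus> y) [^] (p ^ i)) [^] p"
    using x y by (simp add: nat_pow_pow mult.commute[of p])
  also have "\<dots> = x [^] (p ^ Suc i) \<oplus> y [^] (p ^ Suc i)"
    unfolding Suc using x y p by (subst freshmans_dream) (auto simp: nat_pow_pow mult.commute[of p])
  finally show ?case .
qed (use x y in simp)

lemma (in domain) add_pow_power_eq_zero:
  assumes "[(p ^ m :: nat)] \<cdot> \<one> = \<zero>"
  shows "[p] \<cdot> \<one> = \<zero>"
  using assms
proof (induction m)
  case (Suc m)
  then show ?case using integral[of "[p] \<cdot> \<one>" "[(p ^ m)] \<cdot> \<one>"] by (auto simp: add_pow_mult_one)
qed simp

section \<open>Subfield and trace fibres of the quadratic extension\<close>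

locale quadratic_extension = field L for L (structure) +
  fixes K :: "'a set" and q :: nat
  assumes q_primepow: "primepow q" and q_odd: "odd q" and order_L: "order L = q\<^sup>2"
    and K_subfield: "subfield K L" and card_K: "card K = q"
begin

lemma q_gt_1: "1 < q"
  using q_primepow primepow_gt_Suc_0 by auto

lemma finite_L: "finite (carrier L)"
  using order_L q_gt_1 by (simp add: order_def card_ge_0_finite)

lemma card_L: "card (carrier L) = q\<^sup>2"
  using order_L by (simp add: order_def)

lemma K_subset: "K \<subseteq> carrier L"
  using K_subfield subfieldE(3) by blast

lemma zero_in_K: "\<zero> \<in> K"
  using K_subfield by (simp add: subfieldE(1) subringE(2))

lemma finite_K: "finite K"
  using K_subset finite_L finite_subset by blast

lemma frobenius_add:
  assumes "x \<in> carrier L" "y \<in> carrier L"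
  shows "(x \<oplus> y) [^] q = x [^] q \<oplus> y [^] q"
proof -
  obtain p k where pk: "prime p" "q = p ^ k"
    using q_primepow by (auto simp: primepow_def)
  \<comment> \<open>The order of the additive group annihilates 1; as it is a power of p and there
    are no zero divisors, p annihilates 1 already.\<close>
  have "[(q\<^sup>2)] \<cdot> \<one> = \<zero>"
    using add.pow_order_eq_1[of \<one>] order_L by (simp add: order_def)
  then have "[(p ^ (k * 2))] \<cdot> \<one> = \<zero>"
    by (simp add: pk power_mult)
  then have "[p] \<cdot> \<one> = \<zero>" by (rule add_pow_power_eq_zero)
  then show ?thesis using freshmans_dream_power[OF pk(1)] assms pk(2) by simp
qed

lemma K_pow_eq_one:
  assumes "x \<in> K - {\<zero>}"
  shows "x [^] (q - 1) = \<one>"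
proof -
  interpret K: field "L\<lparr>carrier := K\<rparr>"
    using K_subfield subfield_iff(2) by blast
  interpret KG: group "mult_of (L\<lparr>carrier := K\<rparr>)"
    by (rule K.field_mult_group)
  have "order (mult_of (L\<lparr>carrier := K\<rparr>)) = q - 1"
    using K.order_mult_of finite_K card_K by (simp add: order_def)
  moreover have "x \<in> carrier (mult_of (L\<lparr>carrier := K\<rparr>))" using assms by simp
  ultimately have "x [^]\<^bsub>mult_of (L\<lparr>carrier := K\<rparr>)\<^esub> (q - 1) = \<one>\<^bsub>mult_of (L\<lparr>carrier := K\<rparr>)\<^esub>"
    using KG.pow_order_eq_1 by metis
  then show ?thesis by (simp add: nat_pow_mult_of nat_pow_consistent[symmetric])
qed

text \<open>The q - 1 nonzero elements of K are roots of X^(q-1) - 1, and a field has no room for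
  further roots.\<close>

lemma in_K_iff:
  assumes "x \<in> carrier L" "x \<noteq> \<zero>"
  shows "x \<in> K \<longleftrightarrow> x [^] (q - 1) = \<one>"
proof -
  let ?U = "{x \<in> carrier L. x [^] (q - 1) = \<one>}"
  have "K - {\<zero>} \<subseteq> ?U" using K_pow_eq_one K_subset by auto
  moreover have "card ?U \<le> card (K - {\<zero>})"
    using num_roots_le_deg[OF finite_L, of "q - 1"] q_gt_1 finite_K zero_in_K card_K
    by (simp add: card_Diff_singleton)
  ultimately have "K - {\<zero>} = ?U"
    using finite_L by (intro card_seteq) auto
  then show ?thesis using assms by blast
qed

lemma in_K_iff_frobenius:
  assumes "x \<in> carrier L"
  shows "x \<in> K \<longleftrightarrow> x [^] q = x"
proof (cases "x = \<zero>")
  case True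
  then show ?thesis using zero_in_K q_gt_1 by (simp add: nat_pow_zero)
next
  case False
  have "q = Suc (q - 1)" using q_gt_1 by simp
  then have "x [^] q = x [^] (q - 1) \<otimes> x" by (metis nat_pow_Suc)
  then have "x [^] q = x \<longleftrightarrow> x [^] (q - 1) \<otimes> x = \<one> \<otimes> x" using assms by simp
  also have "\<dots> \<longleftrightarrow> x [^] (q - 1) = \<one>"
    using assms False by (intro m_rcancel) auto
  finally show ?thesis using in_K_iff[OF assms False] by simp
qed

lemma pow_q_squared:
  assumes "x \<in> carrier L"
  shows "(x [^] q) [^] q = x"
proof (cases "x = \<zero>")
  case True
  then show ?thesis using q_gt_1 by (simp add: nat_pow_zero)
next
  case False
  interpret G: group "mult_of L" by (rule field_mult_group)
  have "x [^] (q\<^sup>2 - 1) = \<one>"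
    using G.pow_order_eq_1[of x] assms False order_mult_of[OF finite_L] order_L
    by (simp add: nat_pow_mult_of)
  moreover have "(x [^] q) [^] q = x [^] Suc (q\<^sup>2 - 1)"
    using assms q_gt_1 by (simp add: nat_pow_pow power2_eq_square del: nat_pow_Suc)
  ultimately show ?thesis using assms by simp
qed

definition fibre :: "'a \<Rightarrow> 'a set" where
  "fibre \<beta> = {\<xi> \<in> carrier L. quad_trace L q \<xi> = \<beta>}"

lemma trace_in_K: "\<xi> \<in> carrier L \<Longrightarrow> quad_trace L q \<xi> \<in> K"
  by (subst in_K_iff_frobenius)
    (simp_all add: quad_trace_def frobenius_add pow_q_squared a_comm)

lemma finite_fibre: "finite (fibre \<beta>)"
  using finite_L by (simp add: fibre_def)

lemma zero_notin_fibre: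
  assumes "\<beta> \<in> K - {\<zero>}" "\<xi> \<in> fibre \<beta>"
  shows "\<xi> \<noteq> \<zero>"
  using assms q_gt_1 by (auto simp: fibre_def quad_trace_def nat_pow_zero)

lemma fibre_pow_q:
  assumes "\<beta> \<in> K" "\<xi> \<in> fibre \<beta>"
  shows "\<xi> [^] q = \<beta> \<ominus> \<xi>"
proof -
  have c: "\<xi> \<in> carrier L" "\<xi> [^] q \<in> carrier L" "\<beta> = \<xi> \<oplus> \<xi> [^] q"
    using assms by (auto simp: fibre_def quad_trace_def)
  show ?thesis unfolding c(3) using c(1,2) by algebra
qed

text \<open>The trace is K-linear, so multiplying by z in K multiplies \<beta> by z; as \<beta> is
  nonzero, z = 1.\<close>

lemma fibre_ratio_in_K:
  assumes \<beta>: "\<beta> \<in> K - {\<zero>}" and \<eta>: "\<eta> \<in> fibre \<beta>" and z: "z \<in> K" "z \<otimes> \<eta> \<in> fibre \<beta>"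
  shows "z \<otimes> \<eta> = \<eta>"
proof -
  have c: "\<beta> \<in> carrier L" "\<eta> \<in> carrier L" "z \<in> carrier L" "\<beta> \<noteq> \<zero>"
    using assms K_subset by (auto simp: fibre_def)
  have "\<beta> = z \<otimes> \<eta> \<oplus> (z \<otimes> \<eta>) [^] q"
    using z(2) by (simp add: fibre_def quad_trace_def)
  also have "(z \<otimes> \<eta>) [^] q = z \<otimes> \<eta> [^] q"
    using z(1) c in_K_iff_frobenius by (simp add: nat_pow_distrib)
  also have "z \<otimes> \<eta> \<oplus> z \<otimes> \<eta> [^] q = z \<otimes> (\<eta> \<oplus> \<eta> [^] q)"
    using c by (simp add: r_distr)
  also have "\<eta> \<oplus> \<eta> [^] q = \<beta>" using \<eta> by (simp add: fibre_def quad_trace_def)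
  finally have "z \<otimes> \<beta> = \<one> \<otimes> \<beta>" using c by simp
  then have "z = \<one>" using c m_rcancel by blast
  then show ?thesis using c by simp
qed

text \<open>An element \<open>\<eta>\<close> of the fibre with \<open>z \<otimes> \<eta>\<close> in the fibre satisfies the linear equation
  \<open>(z - z\<^sup>q) \<eta> = \<beta> (1 - z\<^sup>q)\<close>.\<close>

lemma fibre_ratio_unique:
  assumes \<beta>: "\<beta> \<in> K" and z: "z \<in> carrier L" "z \<notin> K"
    and \<eta>: "\<eta> \<in> fibre \<beta>" "z \<otimes> \<eta> \<in> fibre \<beta>" and \<theta>: "\<theta> \<in> fibre \<beta>" "z \<otimes> \<theta> \<in> fibre \<beta>"
  shows "\<eta> = \<theta>"
proof -
  have c: "\<beta> \<in> carrier L" "z [^] q \<in> carrier L" using \<beta> z K_subset by auto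
  have lin: "(z \<ominus> z [^] q) \<otimes> x = \<beta> \<ominus> z [^] q \<otimes> \<beta>"
    if x: "x \<in> fibre \<beta>" "z \<otimes> x \<in> fibre \<beta>" for x
  proof -
    have xc: "x \<in> carrier L" using x by (simp add: fibre_def)
    have "z [^] q \<otimes> (\<beta> \<ominus> x) = \<beta> \<ominus> z \<otimes> x"
      using fibre_pow_q[OF \<beta> x(1)] fibre_pow_q[OF \<beta> x(2)] z xc by (simp add: nat_pow_distrib)
    then have "z \<otimes> x \<ominus> (\<beta> \<ominus> (\<beta> \<ominus> z \<otimes> x)) = z \<otimes> x \<ominus> (\<beta> \<ominus> z [^] q \<otimes> (\<beta> \<ominus> x))" by simp
    moreover have "z \<otimes> x \<ominus> (\<beta> \<ominus> (\<beta> \<ominus> z \<otimes> x)) = \<zero>" using c z xc by algebra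
    moreover have "z \<otimes> x \<ominus> (\<beta> \<ominus> z [^] q \<otimes> (\<beta> \<ominus> x)) =
        (z \<ominus> z [^] q) \<otimes> x \<ominus> (\<beta> \<ominus> z [^] q \<otimes> \<beta>)" using c z xc by algebra
    ultimately have "(z \<ominus> z [^] q) \<otimes> x \<ominus> (\<beta> \<ominus> z [^] q \<otimes> \<beta>) = \<zero>" by simp
    then show ?thesis using c z xc by (simp add: r_right_minus_eq)
  qed
  have "z \<ominus> z [^] q \<noteq> \<zero>"
    using z c in_K_iff_frobenius[OF z(1)] by (simp add: r_right_minus_eq)
  moreover have "(z \<ominus> z [^] q) \<otimes> \<eta> = (z \<ominus> z [^] q) \<otimes> \<theta>"
    using lin \<eta> \<theta> by simp
  moreover have "\<eta> \<in> carrier L" "\<theta> \<in> carrier L" using \<eta> \<theta> by (auto simp: fibre_def)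
  ultimately show ?thesis using m_lcancel[of "z \<ominus> z [^] q" \<eta> \<theta>] c z by simp
qed

text \<open>Only injectivity is shown here. It first bounds the size of the fibre; once that size is
  known to be q, counting shows that the ratios exhaust the complement of K.\<close>

lemma fibre_ratio_inj:
  assumes \<beta>: "\<beta> \<in> K - {\<zero>}"
  defines "D \<equiv> {(\<xi>, \<eta>). \<xi> \<in> fibre \<beta> \<and> \<eta> \<in> fibre \<beta> \<and> \<xi> \<noteq> \<eta>}"
  shows "inj_on (\<lambda>(\<xi>, \<eta>). \<xi> \<otimes> inv \<eta>) D" and "(\<lambda>(\<xi>, \<eta>). \<xi> \<otimes> inv \<eta>) ` D \<subseteq> carrier L - K"
proof -
  have D: "\<xi> \<in> carrier L" "\<eta> \<in> carrier L" "\<eta> \<noteq> \<zero>" "inv \<eta> \<in> carrier L" "(\<xi> \<otimes> inv \<eta>) \<otimes> \<eta> = \<xi>"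
    if "(\<xi>, \<eta>) \<in> D" for \<xi> \<eta>
  proof -
    show c: "\<xi> \<in> carrier L" "\<eta> \<in> carrier L" "\<eta> \<noteq> \<zero>"
      using that zero_notin_fibre[OF \<beta>] by (auto simp: D_def fibre_def)
    then have "\<eta> \<in> Units L" by (simp add: field_Units)
    then show "inv \<eta> \<in> carrier L" "(\<xi> \<otimes> inv \<eta>) \<otimes> \<eta> = \<xi>"
      using c by (auto simp: m_assoc)
  qed
  have notin: "\<xi> \<otimes> inv \<eta> \<notin> K" if "(\<xi>, \<eta>) \<in> D" for \<xi> \<eta>
  proof
    assume "\<xi> \<otimes> inv \<eta> \<in> K"
    moreover have "\<eta> \<in> fibre \<beta>" "(\<xi> \<otimes> inv \<eta>) \<otimes> \<eta> \<in> fibre \<beta>"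
      using that D(5)[OF that] by (auto simp: D_def)
    ultimately have "(\<xi> \<otimes> inv \<eta>) \<otimes> \<eta> = \<eta>"
      using fibre_ratio_in_K[OF \<beta>] by blast
    then show False using D(5)[OF that] that by (simp add: D_def)
  qed
  then show "(\<lambda>(\<xi>, \<eta>). \<xi> \<otimes> inv \<eta>) ` D \<subseteq> carrier L - K" using D by auto
  show "inj_on (\<lambda>(\<xi>, \<eta>). \<xi> \<otimes> inv \<eta>) D"
  proof (rule inj_onI, clarsimp)
    fix \<xi> \<eta> \<xi>' \<eta>' assume d: "(\<xi>, \<eta>) \<in> D" "(\<xi>', \<eta>') \<in> D" and eq: "\<xi> \<otimes> inv \<eta> = \<xi>' \<otimes> inv \<eta>'"
    have "\<eta> = \<eta>'"
    proof (rule fibre_ratio_unique)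
      show "\<beta> \<in> K" using \<beta> by simp
      show "\<xi> \<otimes> inv \<eta> \<in> carrier L" "\<xi> \<otimes> inv \<eta> \<notin> K" using D[OF d(1)] notin[OF d(1)] by auto
      show "\<eta> \<in> fibre \<beta>" "\<eta>' \<in> fibre \<beta>" using d by (auto simp: D_def)
      show "\<xi> \<otimes> inv \<eta> \<otimes> \<eta> \<in> fibre \<beta>" using D(5)[OF d(1)] d by (auto simp: D_def)
      show "\<xi> \<otimes> inv \<eta> \<otimes> \<eta>' \<in> fibre \<beta>" unfolding eq using D(5)[OF d(2)] d by (auto simp: D_def)
    qed
    then show "\<xi> = \<xi>' \<and> \<eta> = \<eta>'" using D(5)[OF d(1)] D(5)[OF d(2)] eq by metis
  qed
qed

lemma card_diff_K: "card (carrier L - K) = q * q - q"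
  using card_Diff_subset[OF finite_K K_subset] card_K card_L by (simp add: power2_eq_square)

text \<open>For nonzero \<beta> and a fibre of size c, injectivity of the ratios gives c (c - 1) <=
  q (q - 1). The fibre over zero lies in the K-multiples of any of its nonzero elements.\<close>

lemma card_fibre_le:
  assumes "\<beta> \<in> K"
  shows "card (fibre \<beta>) \<le> q"
proof (cases "\<beta> = \<zero>")
  case False
  let ?D = "{(\<xi>, \<eta>). \<xi> \<in> fibre \<beta> \<and> \<eta> \<in> fibre \<beta> \<and> \<xi> \<noteq> \<eta>}"
  let ?c = "card (fibre \<beta>)"
  have "card ?D \<le> card (carrier L - K)"
    using fibre_ratio_inj[of \<beta>] False assms finite_L by (intro card_inj_on_le) auto
  then have le: "?c * ?c - ?c \<le> q * q - q"
    using card_offdiag[OF finite_fibre] card_diff_K by simp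
  show ?thesis
  proof (rule ccontr)
    assume "\<not> ?c \<le> q"
    then have "q * (q - 1) < ?c * (?c - 1)" using q_gt_1 by (intro mult_strict_mono) auto
    then show False using le by (simp add: right_diff_distrib')
  qed
next
  case True
  show ?thesis
  proof (cases "fibre \<zero> \<subseteq> {\<zero>}")
    case sub: True
    then have "card (fibre \<zero>) \<le> card {\<zero>}" by (intro card_mono) auto
    then show ?thesis using True q_gt_1 by simp
  next
    case False
    then obtain t where t: "t \<in> fibre \<zero>" "t \<noteq> \<zero>" by blast
    have tc: "t \<in> carrier L" "inv t \<in> carrier L" "inv t \<otimes> t = \<one>" "t \<otimes> inv t = \<one>"
      using t by (auto simp: fibre_def field_Units)
    have "x \<otimes> inv t \<in> K" if x: "x \<in> fibre \<zero>" for x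
    proof -
      have xc: "x \<in> carrier L" using x by (simp add: fibre_def)
      have p: "x [^] q = \<ominus> x" "t [^] q = \<ominus> t"
        using fibre_pow_q[OF zero_in_K x] fibre_pow_q[OF zero_in_K t(1)] xc tc by (auto simp: minus_eq)
      have "(x \<otimes> inv t) [^] q \<otimes> t [^] q = x [^] q"
        using xc tc by (simp add: nat_pow_distrib[symmetric] m_assoc)
      then have "\<ominus> ((x \<otimes> inv t) [^] q \<otimes> t) = \<ominus> x" using p xc tc by (simp add: r_minus)
      then have "(x \<otimes> inv t) [^] q \<otimes> t = x" using xc tc by (metis minus_minus m_closed nat_pow_closed)
      then have "(x \<otimes> inv t) [^] q \<otimes> t \<otimes> inv t = x \<otimes> inv t" by simp
      then have "(x \<otimes> inv t) [^] q = x \<otimes> inv t" using xc tc by (simp add: m_assoc)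
      then show ?thesis using in_K_iff_frobenius xc tc by simp
    qed
    moreover have "inj_on (\<lambda>x. x \<otimes> inv t) (fibre \<zero>)"
      by (rule inj_on_inverseI[of _ "\<lambda>y. y \<otimes> t"]) (use tc in \<open>auto simp: fibre_def m_assoc\<close>)
    ultimately have "card (fibre \<zero>) \<le> card K"
      using finite_K by (intro card_inj_on_le) auto
    then show ?thesis using True card_K by simp
  qed
qed

text \<open>The q fibres partition q^2 elements and none has more than q, so none can have
  fewer.\<close>

lemma card_fibre:
  assumes "\<beta> \<in> K"
  shows "card (fibre \<beta>) = q"
proof (rule ccontr)
  assume "card (fibre \<beta>) \<noteq> q"
  then have "card (fibre \<beta>) < q" using card_fibre_le[OF assms] by simp
  then have "(\<Sum>\<beta>\<in>K. card (fibre \<beta>)) < (\<Sum>\<beta>\<in>K. q)"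
    using assms card_fibre_le finite_K by (intro sum_strict_mono_ex1) auto
  moreover have "carrier L = (\<Union>\<beta>\<in>K. fibre \<beta>)"
    using trace_in_K by (auto simp: fibre_def)
  then have "card (carrier L) = (\<Sum>\<beta>\<in>K. card (fibre \<beta>))"
    using card_UN_disjoint[OF finite_K, of fibre] finite_fibre by (auto simp: fibre_def)
  ultimately show False using card_K card_L by (simp add: power2_eq_square)
qed

text \<open>Expanding the squared absolute value over pairs, the diagonal gives q and the
  differences of distinct exponents run once through the non-multiples of q + 1 below M. The sum
  over all residues vanishes, so the sum over the multiples of q + 1 is subtracted: it is q - 1 if q
  - 1 divides j and 0 otherwise. The result is 1 or q.\<close>

theorem fibre_spectral_set:
  assumes \<beta>: "\<beta> \<in> K - {\<zero>}" and g: "g \<in> carrier (mult_of L)" "group.ord (mult_of L) g = q\<^sup>2 - 1"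
  shows "spectral_set q {a. a < q\<^sup>2 - 1 \<and> g [^] a \<in> fibre \<beta>}"
proof -
  interpret G: group "mult_of L" by (rule field_mult_group)
  define M where "M = q\<^sup>2 - 1"
  define A where "A = {a. a < M \<and> g [^] a \<in> fibre \<beta>}"
  have M_eq: "M = (q - 1) * (q + 1)"
    unfolding M_def by (simp add: power2_eq_square algebra_simps diff_mult_distrib2)
  have Mpos: "0 < M" using q_gt_1 by (simp add: M_eq)
  have gc: "g \<in> carrier L" "g \<noteq> \<zero>" using g by auto
  have gpow: "g [^] (n::nat) \<in> carrier L" "g [^] n \<noteq> \<zero>" for n
    using G.nat_pow_closed[OF g(1), of n] by (auto simp: nat_pow_mult_of)
  have one_iff: "g [^] (n::nat) = \<one> \<longleftrightarrow> M dvd n" for n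
    using G.pow_eq_id[OF g(1), of n] g(2) by (simp add: nat_pow_mult_of M_def)
  have gmod: "g [^] (n mod M) = g [^] n" for n :: nat
  proof -
    have "g [^] n = g [^] (M * (n div M) + n mod M)" by simp
    also have "\<dots> = g [^] (M * (n div M)) \<otimes> g [^] (n mod M)"
      using gc by (simp only: nat_pow_mult)
    also have "g [^] (M * (n div M)) = \<one>" using one_iff by simp
    finally show ?thesis using gpow by simp
  qed
  have inj: "inj_on (\<lambda>a. g [^] a) {..<M}"
  proof -
    have "inj_on (\<lambda>a. g [^]\<^bsub>mult_of L\<^esub> a) {0..group.ord (mult_of L) g - 1}"
      by (intro G.ord_inj g finite_mult_of finite_L)
    moreover have "{..<M} = {0..group.ord (mult_of L) g - 1}"
      using Mpos unfolding g(2) M_def by auto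
    ultimately show ?thesis by (simp add: nat_pow_mult_of)
  qed
  have img: "(\<lambda>a. g [^] a) ` {..<M} = carrier L - {\<zero>}"
  proof (rule card_subset_eq)
    show "card ((\<lambda>a. g [^] a) ` {..<M}) = card (carrier L - {\<zero>})"
      using card_image[OF inj] card_L finite_L by (simp add: card_Diff_singleton M_def)
  qed (use finite_L gpow in auto)
  have finA: "finite A" by (simp add: A_def)
  have bijA: "bij_betw (\<lambda>a. g [^] a) A (fibre \<beta>)"
  proof (rule bij_betw_imageI)
    show "inj_on (\<lambda>a. g [^] a) A" by (rule inj_on_subset[OF inj]) (auto simp: A_def)
    show "(\<lambda>a. g [^] a) ` A = fibre \<beta>"
    proof
      show "fibre \<beta> \<subseteq> (\<lambda>a. g [^] a) ` A"
      proof
        fix x assume x: "x \<in> fibre \<beta>"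
        then have "x \<in> carrier L - {\<zero>}" using zero_notin_fibre[OF \<beta>] by (auto simp: fibre_def)
        then obtain a where "a < M" "x = g [^] a" using img by blast
        then show "x \<in> (\<lambda>a. g [^] a) ` A" using x by (auto simp: A_def)
      qed
    qed (auto simp: A_def)
  qed
  then have cardA: "card A = q" using card_fibre \<beta> bij_betw_same_card by (metis DiffD1)
  have K_iff: "g [^] (k::nat) \<in> K \<longleftrightarrow> (q + 1) dvd k" for k
  proof -
    have "g [^] k \<in> K \<longleftrightarrow> (g [^] k) [^] (q - 1) = \<one>" using in_K_iff gpow by blast
    also have "\<dots> \<longleftrightarrow> M dvd k * (q - 1)" using one_iff gc by (simp add: nat_pow_pow)
    also have "\<dots> \<longleftrightarrow> (q + 1) dvd k"
      unfolding M_eq mult.commute[of k] using q_gt_1 by (intro dvd_times_left_cancel_iff) simp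
    finally show ?thesis .
  qed
  define D where "D = {(a, b). a \<in> A \<and> b \<in> A \<and> a \<noteq> b}"
  \<comment> \<open>In natural numbers \<open>M - b\<close> plays the role of -b modulo M, as the
    elements of A are below M.\<close>
  define d where "d = (\<lambda>(a, b). (a + (M - b)) mod M)"
  have finD: "finite D" using finite_subset[of D "A \<times> A"] finA by (auto simp: D_def)
  have dpow: "g [^] (d (a, b)) = g [^] a \<otimes> inv (g [^] b)" if "b \<in> A" for a b
  proof -
    have "g [^] (M - b) \<otimes> g [^] b = \<one>"
      using that one_iff[of M] gc by (simp add: nat_pow_mult A_def)
    then have "inv (g [^] b) = g [^] (M - b)"
      using gpow inv_unique'[of "g [^] (M - b)" "g [^] b"] by (metis comm_inv_char m_comm)
    then show ?thesis using gc by (simp add: d_def gmod nat_pow_mult[symmetric])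
  qed
  have bijD: "bij_betw d D {k. k < M \<and> \<not> (q + 1) dvd k}"
  proof -
    have gA: "g [^] a \<in> fibre \<beta>" if "a \<in> A" for a using that by (simp add: A_def)
    have neq: "g [^] a \<noteq> g [^] b" if "a \<in> A" "b \<in> A" "a \<noteq> b" for a b
      using inj_onD[OF inj, of a b] that by (auto simp: A_def)
    have injd: "inj_on d D"
    proof (rule inj_onI)
      fix x y assume "x \<in> D" "y \<in> D" and eq: "d x = d y"
      then obtain a b a' b' where xy: "x = (a, b)" "y = (a', b')" "a \<in> A" "b \<in> A" "a \<noteq> b"
          "a' \<in> A" "b' \<in> A" "a' \<noteq> b'" by (auto simp: D_def)
      then have "g [^] a \<otimes> inv (g [^] b) = g [^] a' \<otimes> inv (g [^] b')"
        using dpow eq by metis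
      then have "(g [^] a, g [^] b) = (g [^] a', g [^] b')"
        using inj_onD[OF fibre_ratio_inj(1)[OF \<beta>], of "(g [^] a, g [^] b)" "(g [^] a', g [^] b')"]
          xy gA neq by auto
      then show "x = y" using xy inj_onD[OF inj] by (auto simp: A_def)
    qed
    have sub: "d ` D \<subseteq> {k. k < M \<and> \<not> (q + 1) dvd k}"
    proof (clarsimp simp: D_def)
      fix a b assume ab: "a \<in> A" "b \<in> A" "a \<noteq> b"
      have "g [^] a \<otimes> inv (g [^] b) \<in> carrier L - K"
        using fibre_ratio_inj(2)[OF \<beta>] gA neq ab by blast
      then have "\<not> (q + 1) dvd d (a, b)" unfolding K_iff[symmetric] dpow[OF ab(2)] by blast
      then show "d (a, b) < M \<and> \<not> Suc q dvd d (a, b)" using Mpos by (simp add: d_def)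
    qed
    \<comment> \<open>Surjectivity by counting: powers of g embed the non-multiples of q + 1 into
      the complement of K, which has q^2 - q elements, as many as D.\<close>
    have "card {k. k < M \<and> \<not> (q + 1) dvd k} \<le> card (d ` D)"
    proof -
      have "card {k. k < M \<and> \<not> (q + 1) dvd k} = card ((\<lambda>a. g [^] a) ` {k. k < M \<and> \<not> (q + 1) dvd k})"
        by (rule card_image[symmetric], rule inj_on_subset[OF inj]) auto
      also have "\<dots> \<le> card (carrier L - K)"
        using gpow K_iff finite_L by (intro card_mono) auto
      also have "\<dots> = card D"
        unfolding D_def card_offdiag[OF finA] cardA card_diff_K ..
      also have "\<dots> = card (d ` D)" using card_image[OF injd] by simp
      finally show ?thesis .
    qed
    then have "d ` D = {k. k < M \<and> \<not> (q + 1) dvd k}" using sub by (intro card_seteq) auto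
    then show ?thesis using injd by (intro bij_betw_imageI)
  qed
  have norm_eq: "(cmod (\<Sum>a\<in>A. ecis M j a))\<^sup>2 = (if (q - 1) dvd j then 1 else real q)"
    if j: "\<not> M dvd j" for j
  proof -
    have cross: "ecis M j a * cnj (ecis M j b) = ecis M j (d (a, b))" if "b \<in> A" for a b
    proof -
      have "ecis M j (M - b) * ecis M j b = 1"
      proof -
        have "ecis M j (M - b) * ecis M j b = ecis M j M"
          using that by (simp add: A_def flip: ecis_add_right)
        also have "\<dots> = 1" using ecis_period[OF Mpos, of 1 j] ecis_commute by simp
        finally show ?thesis .
      qed
      moreover have "ecis M j b * cnj (ecis M j b) = 1" by (simp add: complex_norm_square[symmetric])
      ultimately have "cnj (ecis M j b) = ecis M j (M - b)"
        by (metis mult.assoc mult.commute mult.right_neutral)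
      then show ?thesis by (simp add: d_def ecis_mod_right[OF Mpos] ecis_add_right)
    qed
    have "complex_of_real ((cmod (\<Sum>a\<in>A. ecis M j a))\<^sup>2) = (\<Sum>a\<in>A. ecis M j a) * cnj (\<Sum>a\<in>A. ecis M j a)"
      by (simp only: complex_norm_square)
    also have "\<dots> = (\<Sum>(a, b)\<in>A \<times> A. ecis M j a * cnj (ecis M j b))"
      by (simp add: sum_product sum.cartesian_product)
    also have "A \<times> A = (\<lambda>a. (a, a)) ` A \<union> D" by (auto simp: D_def)
    also have "(\<Sum>(a, b)\<in>(\<lambda>a. (a, a)) ` A \<union> D. ecis M j a * cnj (ecis M j b)) =
        (\<Sum>(a, b)\<in>(\<lambda>a. (a, a)) ` A. ecis M j a * cnj (ecis M j b)) +
        (\<Sum>(a, b)\<in>D. ecis M j a * cnj (ecis M j b))"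
      using finA finD by (intro sum.union_disjoint) (auto simp: D_def)
    also have "(\<Sum>(a, b)\<in>(\<lambda>a. (a, a)) ` A. ecis M j a * cnj (ecis M j b)) = of_nat q"
      using cardA by (subst sum.reindex) (auto simp: inj_on_def complex_norm_square[symmetric])
    also have "(\<Sum>(a, b)\<in>D. ecis M j a * cnj (ecis M j b)) = (\<Sum>x\<in>D. ecis M j (d x))"
      by (rule sum.cong) (auto simp: D_def cross)
    also have "\<dots> = (\<Sum>k | k < M \<and> \<not> (q + 1) dvd k. ecis M j k)"
      by (rule sum.reindex_bij_betw[OF bijD])
    also have "\<dots> = (\<Sum>k<M. ecis M j k) - (\<Sum>k | k < M \<and> (q + 1) dvd k. ecis M j k)"
    proof -
      have "{..<M} = {k. k < M \<and> \<not> (q + 1) dvd k} \<union> {k. k < M \<and> (q + 1) dvd k}" by auto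
      moreover have "(\<Sum>k\<in>{k. k < M \<and> \<not> (q + 1) dvd k} \<union> {k. k < M \<and> (q + 1) dvd k}. ecis M j k) =
        (\<Sum>k | k < M \<and> \<not> (q + 1) dvd k. ecis M j k) + (\<Sum>k | k < M \<and> (q + 1) dvd k. ecis M j k)"
        by (intro sum.union_disjoint) auto
      ultimately show ?thesis by simp
    qed
    also have "(\<Sum>k<M. ecis M j k) = 0"
      using sum_ecis[OF Mpos, of j] j by (simp add: ecis_commute[of M j])
    \<comment> \<open>These are the exponents of the nonzero elements of K; on them the character
      becomes one modulo q - 1.\<close>
    also have "(\<Sum>k | k < M \<and> (q + 1) dvd k. ecis M j k) = (\<Sum>i<q - 1. ecis (q - 1) i j)"
    proof -
      have "{k. k < M \<and> (q + 1) dvd k} = (\<lambda>i. i * (q + 1)) ` {..<q - 1}"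
        unfolding M_eq by (rule multiples_below) simp
      moreover have "ecis M j (i * (q + 1)) = ecis (q - 1) i j" for i
      proof -
        have q0: "0 < q - 1" using q_gt_1 by simp
        have "M div (q - 1) = q + 1"
          unfolding M_eq by (rule nonzero_mult_div_cancel_left) (use q0 in simp)
        moreover have "(q - 1) dvd M" unfolding M_eq by (rule dvd_triv_left)
        ultimately show ?thesis using ecis_cancel[OF q0 _ Mpos, of i j] by (simp only: ecis_commute[of M j])
      qed
      moreover have "inj_on (\<lambda>i. i * (q + 1)) {..<q - 1}"
        by (rule inj_onI, subst (asm) mult_cancel2) simp
      ultimately show ?thesis by (simp only: sum.reindex o_def)
    qed
    also have "\<dots> = (if (q - 1) dvd j then of_nat (q - 1) else 0)"
      using q_gt_1 by (intro sum_ecis) simp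
    finally have "complex_of_real ((cmod (\<Sum>a\<in>A. ecis M j a))\<^sup>2) =
        complex_of_real (if (q - 1) dvd j then 1 else real q)"
      using q_gt_1 by (auto simp: of_nat_diff)
    then show ?thesis by (simp only: of_real_eq_iff)
  qed
  have "spectral_set q A"
  proof
    fix j assume j: "\<not> (q\<^sup>2 - 1) dvd j"
    then have eq: "(cmod (\<Sum>a\<in>A. ecis (q\<^sup>2 - 1) j a))\<^sup>2 = (if (q - 1) dvd j then 1 else real q)"
      using norm_eq unfolding M_def by blast
    show "cmod (\<Sum>a\<in>A. ecis (q\<^sup>2 - 1) j a) \<le> sqrt q"
      by (rule real_le_rsqrt) (use eq q_gt_1 in auto)
    show "cmod (\<Sum>a\<in>A. ecis (q\<^sup>2 - 1) j a) \<le> 1" if "(q - 1) dvd j"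
      using eq that by (simp add: power2_eq_1_iff) linarith
  qed (use q_odd q_gt_1 finA cardA in auto)
  then show ?thesis unfolding A_def M_def .
qed

lemma ex_generator:
  "\<exists>g\<in>carrier (mult_of L). group.ord (mult_of L) g = q\<^sup>2 - 1"
proof -
  interpret G: group "mult_of L" by (rule field_mult_group)
  have fin: "finite (carrier (mult_of L))" using finite_L by (simp add: finite_mult_of)
  obtain g where g: "g \<in> carrier (mult_of L)"
      "carrier (mult_of L) = {g [^] i | i::nat. i \<in> UNIV}"
    using finite_field_mult_group_has_gen[OF finite_L] by blast
  have "card (carrier (mult_of L)) = card ((\<lambda>i. g [^]\<^bsub>mult_of L\<^esub> i) ` {0..group.ord (mult_of L) g - 1})"
    using g(2) G.ord_elems[OF fin g(1)] by (simp add: nat_pow_mult_of image_def Bex_def conj_commute)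
  also have "\<dots> = card {0..group.ord (mult_of L) g - 1}"
    by (intro card_image G.ord_inj fin g)
  also have "\<dots> = group.ord (mult_of L) g" using G.ord_ge_1[OF fin g(1)] by simp
  finally have "group.ord (mult_of L) g = order (mult_of L)" by (simp add: order_def)
  then show ?thesis using g(1) order_mult_of[OF finite_L] order_L by auto
qed

theorem ex_two_primitive:
  assumes \<beta>: "\<beta> \<in> K - {\<zero>}"
    and ex: "\<And>A. spectral_set q A \<Longrightarrow> \<exists>a\<in>A. gcd (q\<^sup>2 - 1) a = 2"
  shows "\<exists>\<xi>\<in>carrier L. two_primitive L q \<xi> \<and> quad_trace L q \<xi> = \<beta>"
proof -
  interpret G: group "mult_of L" by (rule field_mult_group)
  obtain g where g: "g \<in> carrier (mult_of L)" "group.ord (mult_of L) g = q\<^sup>2 - 1"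
    using ex_generator by blast
  obtain a where a: "a < q\<^sup>2 - 1" "g [^] a \<in> fibre \<beta>" "gcd (q\<^sup>2 - 1) a = 2"
    using ex[OF fibre_spectral_set[OF \<beta> g]] by blast
  \<comment> \<open>The formula for the order of a power singles out the exponent 0, for which the
    gcd would be M itself and q^2 would be 3.\<close>
  have "a \<noteq> 0"
  proof
    assume "a = 0"
    then have "q\<^sup>2 = 3" using a by auto
    moreover have "3\<^sup>2 \<le> q\<^sup>2" using q_gt_1 q_odd by (intro power_mono) presburger+
    ultimately show False by simp
  qed
  then have "group.ord (mult_of L) (g [^] a) = (q\<^sup>2 - 1) div 2"
    using G.ord_pow_gen[OF g(1), of a] g(2) a(3) by (simp add: nat_pow_mult_of)
  moreover have "g [^] a \<in> carrier (mult_of L)"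
    using G.nat_pow_closed[OF g(1), of a] by (simp add: nat_pow_mult_of)
  ultimately have "two_primitive L q (g [^] a)" by (simp add: two_primitive_def)
  then show ?thesis using a(2) by (auto simp: fibre_def)
qed

end

theorem theorem8p6:
  fixes L :: "('a, 'b) ring_scheme" and K :: "'a set" and q :: nat
  assumes "primepow q" and "odd q" and "q \<notin> exceptional_set"
    and "field L" and "order L = q\<^sup>2"
    and "subfield K L" and "card K = q"
  shows "\<forall>\<beta> \<in> K - {\<zero>\<^bsub>L\<^esub>}. \<exists>\<xi> \<in> carrier L. two_primitive L q \<xi> \<and> quad_trace L q \<xi> = \<beta>"
proof
  fix \<beta> assume \<beta>: "\<beta> \<in> K - {\<zero>\<^bsub>L\<^esub>}"
  interpret quadratic_extension L K q
    by (intro quadratic_extension.intro quadratic_extension_axioms.intro assms)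
  show "\<exists>\<xi> \<in> carrier L. two_primitive L q \<xi> \<and> quad_trace L q \<xi> = \<beta>"
  proof (rule ex_two_primitive[OF \<beta>])
    fix A assume "spectral_set q A"
    then interpret S: spectral_set q A .
    have "\<exists>a\<in>A. gcd S.M a = 2"
    proof (cases "14610 \<le> q")
      case True
      then show ?thesis by (rule S.exists_large)
    next
      case False
      then have "crit_holds q" using S.q_ge_3 assms(2) by (intro crit_holds_small) simp_all
      then show ?thesis
        using S.crit_imp assms(1,3) unfolding crit_holds_def by blast
    qed
    then show "\<exists>a\<in>A. gcd (q\<^sup>2 - 1) a = 2" unfolding S.M_def .
  qed
qed

end
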